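(* For any sufficiently small $\lambda > 0$ there exists an $\varepsilon > 0$ that is admissible for $\lambda$ (in the sense defined in the context) such that for any energy $E \in (2 + \lambda - \varepsilon, 2 + \lambda)$, the set of bi-infinite sequences $V \in \{0, \lambda\}^{\mathbb{Z}}$ for which $E$ is the maximal energy in the spectrum of the Schrödinger operator $H_V$ has positive Hausdorff dimension.
   Context: For $V \in \{0,\lambda\}^{\mathbb{Z}}$, the Schrödinger operator $H_V$ acts on $\ell^2(\mathbb{Z})$ by $[H_V\psi](n) = \psi(n+1) + \psi(n-1) + V(n)\psi(n)$. Call $\varepsilon > 0$ admissible for $\lambda$ if for every $E \in (2+\lambda-\varepsilon, 2+\lambda)$ there exists $V \in \{0,\lambda\}^{\mathbb{Z}}$ such that $E = \max \sigma(H_V)$, $E$ is an eigenvalue of $H_V$, and the corresponding eigenfunction is exponentially decaying and (up to a multiplicative constant) has strictly positive components. The space of bi-infinite sequences $\{0,\lambda\}^{\mathbb{Z}}$ is equipped with one of the standard metrics, for example $d(\omega, \bar\omega) = 0$ if $\omega = \bar\omega$ and $d(\omega, \bar\omega) = 2^{-k}$ if $\omega_i = \bar\omega_i$ for $|i| < k$ and either $\omega_k \neq \bar\omega_k$ or $\omega_{-k} \neq \bar\omega_{-k}$; or $d(\omega, \bar\omega) = \sum_{n=-\infty}^{\infty} 2^{-|n|} |\omega_n - \bar\omega_n|$. (Which of these is used does not matter for positivity of the Hausdorff dimension.) *)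

theory Defs
  imports "HOL-Analysis.Analysis"
begin

section \<open>Hausdorff dimension in a metric space\<close>

context Metric_space
begin

definition ediam :: "'a set \<Rightarrow> ennreal" where
  "ediam U = (SUP x\<in>U. SUP y\<in>U. ennreal (d x y))"

text \<open>The conventions at \<open>s = 0\<close> make the zero-dimensional measure the counting measure.
  Note that \<open>0 powr 0 = 0\<close> in HOL.\<close>

definition diam_pow :: "real \<Rightarrow> 'a set \<Rightarrow> ennreal" where
  "diam_pow s U = (if U = {} then 0 else if s = 0 then 1 else ennreal (enn2real (ediam U) powr s))"

definition hausdorff_premeasure :: "real \<Rightarrow> real \<Rightarrow> 'a set \<Rightarrow> ennreal" where
  "hausdorff_premeasure s \<delta> S =
     (INF U\<in>{U :: nat \<Rightarrow> 'a set. (\<forall>i. U i \<subseteq> M \<and> ediam (U i) \<le> ennreal \<delta>) \<and> S \<subseteq> (\<Union>i. U i)}.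
        \<Sum>i. diam_pow s (U i))"

definition hausdorff_measure :: "real \<Rightarrow> 'a set \<Rightarrow> ennreal" where
  "hausdorff_measure s S = (SUP \<delta>\<in>{0<..}. hausdorff_premeasure s \<delta> S)"

definition hausdorff_dim :: "'a set \<Rightarrow> ennreal" where
  "hausdorff_dim S = (INF s\<in>{s. 0 \<le> s \<and> hausdorff_measure s S = 0}. ennreal s)"

end


section \<open>The space of two-valued bi-infinite sequences\<close>

definition two_valued :: "real \<Rightarrow> (int \<Rightarrow> real) set" where
  "two_valued lam = {V. \<forall>n. V n \<in> {0, lam}}"

definition seq_dist :: "(int \<Rightarrow> real) \<Rightarrow> (int \<Rightarrow> real) \<Rightarrow> real" where
  "seq_dist \<omega> \<omega>' =
     (if \<omega> = \<omega>' then 0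
      else (1/2) ^ (LEAST k::nat. \<omega> (int k) \<noteq> \<omega>' (int k) \<or> \<omega> (- int k) \<noteq> \<omega>' (- int k)))"

definition seq_dist_sum :: "(int \<Rightarrow> real) \<Rightarrow> (int \<Rightarrow> real) \<Rightarrow> real" where
  "seq_dist_sum \<omega> \<omega>' = (\<Sum>\<^sub>\<infinity>n\<in>UNIV. (1/2) ^ nat \<bar>n\<bar> * \<bar>\<omega> n - \<omega>' n\<bar>)"

lemma Metric_space_seq_dist: "Metric_space (two_valued lam) seq_dist"
proof
  fix x y z :: "int \<Rightarrow> real"
  show "0 \<le> seq_dist x y" by (simp add: seq_dist_def)
  show "seq_dist x y = seq_dist y x" by (simp add: seq_dist_def eq_commute)
  show "seq_dist x y = 0 \<longleftrightarrow> x = y" by (simp add: seq_dist_def)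
  let ?D = "\<lambda>x y (k::nat). x (int k) \<noteq> (y (int k) :: real) \<or> x (- int k) \<noteq> y (- int k)"
  have le: "(1/2) ^ k \<le> seq_dist u v" if D: "?D u v k" for u v k
  proof -
    have "(LEAST k. ?D u v k) \<le> k" using D by (rule Least_le)
    moreover have "u \<noteq> v" using D by auto
    ultimately show ?thesis by (simp add: seq_dist_def power_decreasing)
  qed
  show "seq_dist x z \<le> seq_dist x y + seq_dist y z"
  proof (cases "x = z")
    case True
    then show ?thesis by (simp add: seq_dist_def)
  next
    case False
    then obtain n where n: "x n \<noteq> z n" by auto
    have "?D x z (nat \<bar>n\<bar>)" using n by (cases "n \<ge> 0") auto
    then have K: "?D x z (LEAST k. ?D x z k)" by (rule LeastI)
    define K where "K = (LEAST k. ?D x z k)"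
    have "?D x y K \<or> ?D y z K" using K unfolding K_def[symmetric] by metis
    then have "(1/2) ^ K \<le> seq_dist x y \<or> (1/2) ^ K \<le> seq_dist y z" using le by blast
    moreover have "seq_dist x z = (1/2) ^ K" using False by (simp add: seq_dist_def K_def)
    moreover have "0 \<le> seq_dist x y" "0 \<le> seq_dist y z" by (simp_all add: seq_dist_def)
    ultimately show ?thesis by linarith
  qed
qed

lemma summable_on_half_power_abs: "(\<lambda>n::int. (1/2::real) ^ nat \<bar>n\<bar>) summable_on UNIV"
proof -
  have geo: "(\<lambda>n::nat. (1/2::real) ^ n) summable_on UNIV"
    by (rule norm_summable_imp_summable_on) (simp add: summable_geometric)
  have 1: "(\<lambda>n::int. (1/2::real) ^ nat \<bar>n\<bar>) summable_on range int"
    by (subst summable_on_reindex) (use geo in \<open>auto simp: o_def inj_on_def\<close>)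
  have 2: "(\<lambda>n::int. (1/2::real) ^ nat \<bar>n\<bar>) summable_on range (\<lambda>k. - int k)"
    by (subst summable_on_reindex) (use geo in \<open>auto simp: o_def inj_on_def\<close>)
  have "(UNIV::int set) = range int \<union> range (\<lambda>k. - int k)"
    by (auto simp: image_iff) (metis int_cases2)
  then show ?thesis using summable_on_union[OF 1 2] by simp
qed

lemma summable_on_seq_dist_sum:
  assumes "\<omega> \<in> two_valued lam" "\<omega>' \<in> two_valued lam"
  shows "(\<lambda>n::int. (1/2) ^ nat \<bar>n\<bar> * \<bar>\<omega> n - \<omega>' n\<bar>) summable_on UNIV"
proof (rule summable_on_comparison_test)
  show "(\<lambda>n::int. (1/2::real) ^ nat \<bar>n\<bar> * \<bar>lam\<bar>) summable_on UNIV"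
    by (intro summable_on_cmult_left summable_on_half_power_abs)
  fix n :: int
  have "\<omega> n \<in> {0, lam}" "\<omega>' n \<in> {0, lam}" using assms by (auto simp: two_valued_def)
  then have "\<bar>\<omega> n - \<omega>' n\<bar> \<le> \<bar>lam\<bar>" by auto
  then show "(1/2) ^ nat \<bar>n\<bar> * \<bar>\<omega> n - \<omega>' n\<bar> \<le> (1/2) ^ nat \<bar>n\<bar> * \<bar>lam\<bar>"
    by (intro mult_left_mono) auto
qed simp_all

lemma Metric_space_seq_dist_sum: "Metric_space (two_valued lam) seq_dist_sum"
proof
  fix x y z :: "int \<Rightarrow> real"
  show "0 \<le> seq_dist_sum x y" unfolding seq_dist_sum_def by (rule infsum_nonneg) simp
  show "seq_dist_sum x y = seq_dist_sum y x" by (simp add: seq_dist_sum_def abs_minus_commute)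
  assume x: "x \<in> two_valued lam" and y: "y \<in> two_valued lam"
  show "seq_dist_sum x y = 0 \<longleftrightarrow> x = y"
  proof
    assume 0: "seq_dist_sum x y = 0"
    have "(1/2) ^ nat \<bar>n\<bar> * \<bar>x n - y n\<bar> = 0" for n
      by (rule nonneg_infsum_le_0D[of _ UNIV])
         (use 0 summable_on_seq_dist_sum[OF x y] in \<open>auto simp: seq_dist_sum_def\<close>)
    then show "x = y" by auto
  qed (simp add: seq_dist_sum_def)
  assume z: "z \<in> two_valued lam"
  note s = summable_on_seq_dist_sum
  have "seq_dist_sum x z \<le>
      (\<Sum>\<^sub>\<infinity>n\<in>UNIV. (1/2) ^ nat \<bar>n\<bar> * \<bar>x n - y n\<bar> + (1/2) ^ nat \<bar>n\<bar> * \<bar>y n - z n\<bar>)"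
    unfolding seq_dist_sum_def
    by (intro infsum_mono s[OF x z] summable_on_add s[OF x y] s[OF y z])
       (auto simp flip: distrib_left)
  also have "\<dots> = seq_dist_sum x y + seq_dist_sum y z"
    unfolding seq_dist_sum_def by (rule infsum_add[OF s[OF x y] s[OF y z]])
  finally show "seq_dist_sum x z \<le> seq_dist_sum x y + seq_dist_sum y z" .
qed


section \<open>Operators on the Hilbert space of square-summable sequences\<close>

text \<open>The space is complex; operators on it are functions on all sequences of which
  only the restriction to \<open>l2\<close> matters.\<close>

definition l2 :: "(int \<Rightarrow> complex) set" where
  "l2 = {\<psi>. (\<lambda>n. (cmod (\<psi> n))\<^sup>2) summable_on UNIV}"

definition l2_norm :: "(int \<Rightarrow> complex) \<Rightarrow> real" where
  "l2_norm \<psi> = sqrt (\<Sum>\<^sub>\<infinity>n\<in>UNIV. (cmod (\<psi> n))\<^sup>2)"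

definition bounded_operator :: "((int \<Rightarrow> complex) \<Rightarrow> (int \<Rightarrow> complex)) \<Rightarrow> bool" where
  "bounded_operator T \<longleftrightarrow>
     (\<forall>\<psi>\<in>l2. T \<psi> \<in> l2) \<and>
     (\<forall>\<psi>\<in>l2. \<forall>\<phi>\<in>l2. T (\<lambda>n. \<psi> n + \<phi> n) = (\<lambda>n. T \<psi> n + T \<phi> n)) \<and>
     (\<forall>c. \<forall>\<psi>\<in>l2. T (\<lambda>n. c * \<psi> n) = (\<lambda>n. c * T \<psi> n)) \<and>
     (\<exists>C. \<forall>\<psi>\<in>l2. l2_norm (T \<psi>) \<le> C * l2_norm \<psi>)"

definition resolvent_set :: "((int \<Rightarrow> complex) \<Rightarrow> (int \<Rightarrow> complex)) \<Rightarrow> complex set" where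
  "resolvent_set T =
     {z. \<exists>R. bounded_operator R \<and>
           (\<forall>\<psi>\<in>l2. R (\<lambda>n. T \<psi> n - z * \<psi> n) = \<psi> \<and> (\<lambda>n. T (R \<psi>) n - z * R \<psi> n) = \<psi>)}"

definition spectrum :: "((int \<Rightarrow> complex) \<Rightarrow> (int \<Rightarrow> complex)) \<Rightarrow> complex set" where
  "spectrum T = - resolvent_set T"

definition eigenfunction ::
    "((int \<Rightarrow> complex) \<Rightarrow> (int \<Rightarrow> complex)) \<Rightarrow> complex \<Rightarrow> (int \<Rightarrow> complex) \<Rightarrow> bool" where
  "eigenfunction T z \<psi> \<longleftrightarrow> \<psi> \<in> l2 \<and> \<psi> \<noteq> (\<lambda>n. 0) \<and> T \<psi> = (\<lambda>n. z * \<psi> n)"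

definition eigenvalue :: "((int \<Rightarrow> complex) \<Rightarrow> (int \<Rightarrow> complex)) \<Rightarrow> complex \<Rightarrow> bool" where
  "eigenvalue T z \<longleftrightarrow> (\<exists>\<psi>. eigenfunction T z \<psi>)"


section \<open>Schroedinger operators\<close>

definition schroedinger :: "(int \<Rightarrow> real) \<Rightarrow> (int \<Rightarrow> complex) \<Rightarrow> (int \<Rightarrow> complex)" where
  "schroedinger V \<psi> = (\<lambda>n. \<psi> (n + 1) + \<psi> (n - 1) + complex_of_real (V n) * \<psi> n)"

definition is_max_spectrum :: "(int \<Rightarrow> real) \<Rightarrow> real \<Rightarrow> bool" where
  "is_max_spectrum V E \<longleftrightarrow>
     complex_of_real E \<in> spectrum (schroedinger V) \<and>
     (\<forall>z\<in>spectrum (schroedinger V). z \<in> \<real> \<and> Re z \<le> E)"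

definition exp_decaying :: "(int \<Rightarrow> complex) \<Rightarrow> bool" where
  "exp_decaying \<psi> \<longleftrightarrow> (\<exists>C \<gamma>. \<gamma> > 0 \<and> (\<forall>n. cmod (\<psi> n) \<le> C * exp (- \<gamma> * real_of_int \<bar>n\<bar>)))"

definition positive_up_to_constant :: "(int \<Rightarrow> complex) \<Rightarrow> bool" where
  "positive_up_to_constant \<psi> \<longleftrightarrow> (\<exists>c. \<forall>n. c * \<psi> n \<in> \<real> \<and> Re (c * \<psi> n) > 0)"

text \<open>Quantifying over all eigenfunctions expresses ``the'' eigenfunction: if all of them
  are positive up to a constant, then the eigenspace is one-dimensional.\<close>

definition admissible :: "real \<Rightarrow> real \<Rightarrow> bool" where
  "admissible lam \<epsilon> \<longleftrightarrow>
     \<epsilon> > 0 \<and>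
     (\<forall>E\<in>{2 + lam - \<epsilon><..<2 + lam}. \<exists>V\<in>two_valued lam.
        is_max_spectrum V E \<and>
        eigenvalue (schroedinger V) (complex_of_real E) \<and>
        (\<forall>\<psi>. eigenfunction (schroedinger V) (complex_of_real E) \<psi> \<longrightarrow>
              exp_decaying \<psi> \<and> positive_up_to_constant \<psi>))"

end

theory Submission
  imports Defs
begin

text \<open>A positive solution \<open>\<psi>\<close> of \<open>H\<^sub>V \<psi> = E \<psi>\<close> is encoded in its ratios
  \<open>r(n) = \<psi>(n+1) / \<psi>(n)\<close>, which satisfy \<open>r(n+1) = E - V(n+1) - 1 / r(n)\<close>, and it decays
  exponentially to the right as soon as the ratios stay in an interval \<open>[p, q]\<close> with \<open>q < 1\<close>.
  For \<open>E\<close> slightly below \<open>2 + lam\<close>, the step with \<open>V = 0\<close> increases every ratio in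
  such an interval, provided that \<open>p + 1/p < E\<close>, and the step with \<open>V = lam\<close> decreases it.
  If \<open>lam\<close> is small, the interval can be taken longer than \<open>2 lam\<close>. Then from every ratio at least one of the two steps stays inside,
  and after a bounded number of steps a ratio is reached from which both do
  (\<open>branching_recurs\<close>). Choosing freely at these moments produces a Cantor set of potentials
  on the right half-line, all with the same initial ratio \<open>q = (E - lam) / 2\<close>. Reflecting one
  of them to the left half-line and putting \<open>lam\<close> at the origin satisfies the equation
  there, as \<open>q + q + lam = E\<close>, so that each of these potentials has a positive, exponentially
  decaying eigenfunction with eigenvalue \<open>E\<close> (\<open>potential_ground_state\<close>).

  A positive eigenfunction is a ground state: it gives the form bound \<open>H\<^sub>V \<le> E\<close>, and
  every point of the complex plane off the ray \<open>(-\<infinity>, E]\<close> is in the resolvent set by a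
  Lax-Milgram argument (\<open>is_max_spectrum_of_positive_eigenfunction\<close>). The eigenvalue is
  simple because the Wronskian of two square-summable solutions vanishes
  (\<open>eigenfunction_proportional\<close>).

  For the dimension, the free choices are taken to be the binary digits of a number \<open>t\<close> in
  \<open>[0, 1)\<close>. Since they come at a bounded distance \<open>N\<close> from each other, the distance of two
  such potentials controls the distance of the numbers to the power \<open>N\<close>
  (\<open>potential_expanding\<close>), and comparison with Lebesgue measure on \<open>[0, 1)\<close> bounds the Hausdorff
  dimension below by \<open>1/N\<close> (\<open>hausdorff_dim_ge_of_expanding\<close>).\<close>

section \<open>Square-summable sequences\<close>

lemma l2_boundI:
  assumes "0 \<le> B" and "\<And>F. finite F \<Longrightarrow> (\<Sum>n\<in>F. (cmod (\<phi> n))\<^sup>2) \<le> B\<^sup>2"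
  shows "\<phi> \<in> l2" "l2_norm \<phi> \<le> B"
proof -
  have s: "(\<lambda>n. (cmod (\<phi> n))\<^sup>2) summable_on UNIV"
    by (rule nonneg_bdd_above_summable_on) (auto intro!: bdd_aboveI[of _ "B\<^sup>2"] assms(2))
  then show "\<phi> \<in> l2" by (simp add: l2_def)
  have "(\<Sum>\<^sub>\<infinity>n. (cmod (\<phi> n))\<^sup>2) \<le> B\<^sup>2"
    by (rule infsum_le_finite_sums[OF s]) (auto intro: assms(2))
  then show "l2_norm \<phi> \<le> B"
    unfolding l2_norm_def using assms(1) by (simp add: real_le_lsqrt infsum_nonneg)
qed

lemma l2_norm_nonneg [simp]: "0 \<le> l2_norm \<phi>"
  by (simp add: l2_norm_def infsum_nonneg)

lemma l2_norm_sq: "(l2_norm \<phi>)\<^sup>2 = (\<Sum>\<^sub>\<infinity>n. (cmod (\<phi> n))\<^sup>2)"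
  by (simp add: l2_norm_def infsum_nonneg)

lemma L2_set_le_l2_norm:
  assumes "\<phi> \<in> l2" "finite F"
  shows "L2_set (\<lambda>n. cmod (\<phi> n)) F \<le> l2_norm \<phi>"
  unfolding L2_set_def l2_norm_def
  using assms by (intro real_sqrt_le_mono finite_sum_le_infsum) (auto simp: l2_def)

lemma cmod_le_l2_norm: "\<phi> \<in> l2 \<Longrightarrow> cmod (\<phi> n) \<le> l2_norm \<phi>"
  using L2_set_le_l2_norm[of \<phi> "{n}"] by simp

lemma l2_L2_setI:
  assumes "0 \<le> B" and "\<And>F. finite F \<Longrightarrow> L2_set (\<lambda>n. cmod (\<phi> n)) F \<le> B"
  shows "\<phi> \<in> l2" "l2_norm \<phi> \<le> B"
proof -
  have "(\<Sum>n\<in>F. (cmod (\<phi> n))\<^sup>2) \<le> B\<^sup>2" if "finite F" for F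
    using assms(2)[OF that] unfolding L2_set_def by (simp add: sqrt_le_D)
  then show "\<phi> \<in> l2" "l2_norm \<phi> \<le> B" using l2_boundI[OF assms(1)] by blast+
qed

text \<open>Minkowski's inequality for finite sums passes to \<open>l2\<close>, because the norm
  is the supremum over finite sets of sites.\<close>

lemma l2_add:
  assumes "\<phi> \<in> l2" "\<eta> \<in> l2"
  shows "(\<lambda>n. \<phi> n + \<eta> n) \<in> l2" "l2_norm (\<lambda>n. \<phi> n + \<eta> n) \<le> l2_norm \<phi> + l2_norm \<eta>"
proof -
  have "L2_set (\<lambda>n. cmod (\<phi> n + \<eta> n)) F \<le> l2_norm \<phi> + l2_norm \<eta>" if F: "finite F" for F
  proof -
    have "L2_set (\<lambda>n. cmod (\<phi> n + \<eta> n)) F \<le> L2_set (\<lambda>n. cmod (\<phi> n) + cmod (\<eta> n)) F"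
      by (rule L2_set_mono) (auto simp: norm_triangle_ineq)
    also have "\<dots> \<le> L2_set (\<lambda>n. cmod (\<phi> n)) F + L2_set (\<lambda>n. cmod (\<eta> n)) F"
      by (rule L2_set_triangle_ineq)
    also have "\<dots> \<le> l2_norm \<phi> + l2_norm \<eta>"
      using L2_set_le_l2_norm F assms by (intro add_mono) auto
    finally show ?thesis .
  qed
  then show "(\<lambda>n. \<phi> n + \<eta> n) \<in> l2" "l2_norm (\<lambda>n. \<phi> n + \<eta> n) \<le> l2_norm \<phi> + l2_norm \<eta>"
    using l2_L2_setI[of "l2_norm \<phi> + l2_norm \<eta>"] by auto
qed

lemma l2_dominated:
  assumes "\<phi> \<in> l2" "0 \<le> B" "\<And>n. cmod (\<eta> n) \<le> B * cmod (\<phi> n)"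
  shows "\<eta> \<in> l2" "l2_norm \<eta> \<le> B * l2_norm \<phi>"
proof -
  have "L2_set (\<lambda>n. cmod (\<eta> n)) F \<le> B * l2_norm \<phi>" if F: "finite F" for F
  proof -
    have "L2_set (\<lambda>n. cmod (\<eta> n)) F \<le> L2_set (\<lambda>n. B * cmod (\<phi> n)) F"
      by (rule L2_set_mono) (auto simp: assms)
    also have "\<dots> = B * L2_set (\<lambda>n. cmod (\<phi> n)) F"
      by (rule L2_set_right_distrib[symmetric]) (rule assms)
    finally show ?thesis
      using mult_left_mono[OF L2_set_le_l2_norm[OF assms(1) F] assms(2)] by linarith
  qed
  then show "\<eta> \<in> l2" "l2_norm \<eta> \<le> B * l2_norm \<phi>"
    using l2_L2_setI[of "B * l2_norm \<phi>"] assms(2) by auto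
qed

lemma l2_scale:
  assumes "\<phi> \<in> l2"
  shows "(\<lambda>n. c * \<phi> n) \<in> l2" "l2_norm (\<lambda>n. c * \<phi> n) \<le> cmod c * l2_norm \<phi>"
  using l2_dominated[OF assms, of "cmod c"] by (auto simp: norm_mult)

lemma l2_diff:
  assumes "\<phi> \<in> l2" "\<eta> \<in> l2"
  shows "(\<lambda>n. \<phi> n - \<eta> n) \<in> l2" 
  using l2_add(1)[OF assms(1) l2_scale(1)[OF assms(2), of "-1"]] by simp

lemma l2_zero: "(\<lambda>n. 0) \<in> l2" "l2_norm (\<lambda>n. 0) = 0"
  by (simp_all add: l2_def l2_norm_def)

lemma l2_norm_eq_0: "\<phi> \<in> l2 \<Longrightarrow> l2_norm \<phi> \<le> 0 \<Longrightarrow> \<phi> = (\<lambda>n. 0)"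
proof
  fix n assume "\<phi> \<in> l2" "l2_norm \<phi> \<le> 0"
  then have "cmod (\<phi> n) \<le> 0" using cmod_le_l2_norm[of \<phi> n] by linarith
  then show "\<phi> n = 0" by simp
qed

lemma infsum_int_shift:
  fixes f :: "int \<Rightarrow> 'a::{comm_monoid_add,t2_space}"
  shows "(\<Sum>\<^sub>\<infinity>n. f (n + k)) = (\<Sum>\<^sub>\<infinity>n. f n)"
    and "(\<lambda>n. f (n + k)) summable_on UNIV \<longleftrightarrow> f summable_on UNIV"
proof -
  have b: "bij (\<lambda>n::int. n + k)" by (rule bij_plus_right)
  show "(\<Sum>\<^sub>\<infinity>n. f (n + k)) = (\<Sum>\<^sub>\<infinity>n. f n)"
    by (rule infsum_reindex_bij_betw[OF b])
  show "(\<lambda>n. f (n + k)) summable_on UNIV \<longleftrightarrow> f summable_on UNIV"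
    by (rule summable_on_reindex_bij_betw[OF b])
qed

lemma l2_shift:
  assumes "\<phi> \<in> l2"
  shows "(\<lambda>n. \<phi> (n + k)) \<in> l2" "l2_norm (\<lambda>n. \<phi> (n + k)) = l2_norm \<phi>"
  using infsum_int_shift[of "\<lambda>n. (cmod (\<phi> n))\<^sup>2" k] assms by (simp_all add: l2_def l2_norm_def)

lemma l2_product_summable:
  assumes "\<phi> \<in> l2" "\<eta> \<in> l2"
  shows "(\<lambda>n. \<phi> n * \<eta> n) summable_on UNIV"
proof (rule abs_summable_summable, rule summable_on_comparison_test)
  show "(\<lambda>n. (cmod (\<phi> n))\<^sup>2 + (cmod (\<eta> n))\<^sup>2) summable_on UNIV"
    using assms by (intro summable_on_add) (auto simp: l2_def)
  show "cmod (\<phi> n * \<eta> n) \<le> (cmod (\<phi> n))\<^sup>2 + (cmod (\<eta> n))\<^sup>2" for n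
  proof -
    have "0 \<le> cmod (\<phi> n) * cmod (\<eta> n)" by simp
    then show ?thesis
      using sum_squares_bound[of "cmod (\<phi> n)" "cmod (\<eta> n)"] unfolding norm_mult by linarith
  qed
qed (rule norm_ge_zero)

lemma l2_cnj: "\<phi> \<in> l2 \<Longrightarrow> (\<lambda>n. cnj (\<phi> n)) \<in> l2"
  by (simp add: l2_def)

definition l2_inner :: "(int \<Rightarrow> complex) \<Rightarrow> (int \<Rightarrow> complex) \<Rightarrow> complex" where
  "l2_inner \<phi> \<eta> = (\<Sum>\<^sub>\<infinity>n. cnj (\<phi> n) * \<eta> n)"

lemma summable_on_l2_inner: "\<phi> \<in> l2 \<Longrightarrow> \<eta> \<in> l2 \<Longrightarrow> (\<lambda>n. cnj (\<phi> n) * \<eta> n) summable_on UNIV"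
  by (rule l2_product_summable[OF l2_cnj])

lemma l2_norm_sq_diff:
  assumes "\<phi> \<in> l2" "\<eta> \<in> l2"
  shows "(l2_norm (\<lambda>n. \<phi> n - \<eta> n))\<^sup>2 =
    (l2_norm \<phi>)\<^sup>2 - 2 * Re (l2_inner \<phi> \<eta>) + (l2_norm \<eta>)\<^sup>2"
proof -
  note s = summable_on_l2_inner[OF assms]
  have sr: "(\<lambda>n. Re (cnj (\<phi> n) * \<eta> n)) summable_on UNIV"
    by (rule summable_on_Re[OF s])
  have sq: "(\<lambda>n. (cmod (\<phi> n))\<^sup>2) summable_on UNIV" "(\<lambda>n. (cmod (\<eta> n))\<^sup>2) summable_on UNIV"
    using assms by (auto simp: l2_def)
  have "(cmod (a - b))\<^sup>2 = ((cmod a)\<^sup>2 + (cmod b)\<^sup>2) + (-2) * Re (cnj a * b)" for a b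
    by (simp only: cmod_power2) (simp add: power2_eq_square algebra_simps)
  then have "(l2_norm (\<lambda>n. \<phi> n - \<eta> n))\<^sup>2 =
     (\<Sum>\<^sub>\<infinity>n. ((cmod (\<phi> n))\<^sup>2 + (cmod (\<eta> n))\<^sup>2) + (-2) * Re (cnj (\<phi> n) * \<eta> n))"
    by (simp only: l2_norm_sq)
  also have "\<dots> = (\<Sum>\<^sub>\<infinity>n. (cmod (\<phi> n))\<^sup>2 + (cmod (\<eta> n))\<^sup>2) + (\<Sum>\<^sub>\<infinity>n. (-2) * Re (cnj (\<phi> n) * \<eta> n))"
    by (intro infsum_add summable_on_add sq summable_on_cmult_right sr)
  also have "\<dots> = (\<Sum>\<^sub>\<infinity>n. (cmod (\<phi> n))\<^sup>2) + (\<Sum>\<^sub>\<infinity>n. (cmod (\<eta> n))\<^sup>2) + (-2) * (\<Sum>\<^sub>\<infinity>n. Re (cnj (\<phi> n) * \<eta> n))"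
    by (simp only: infsum_add[OF sq] infsum_cmult_right')
  finally show ?thesis
    unfolding l2_inner_def infsum_Re[OF s] l2_norm_sq by simp
qed

section \<open>Coercive operators\<close>

text \<open>This is the Lax-Milgram argument, by Richardson iteration \<open>u' = u - a (A u - \<eta>)\<close>:
  coercivity makes \<open>\<phi> - a A \<phi>\<close> a strict contraction for a small multiple \<open>a\<close> of \<open>w\<close>. The
  iterates converge at every site and their norms stay bounded, so the pointwise limit is
  square-summable, and \<open>cont\<close> (which
  holds for every operator of finite range) lets the equation pass to the limit.\<close>

lemma coercive_solvable:
  fixes A :: "(int \<Rightarrow> complex) \<Rightarrow> (int \<Rightarrow> complex)"
  assumes M: "\<And>\<phi>. \<phi> \<in> l2 \<Longrightarrow> A \<phi> \<in> l2" "\<And>\<phi>. \<phi> \<in> l2 \<Longrightarrow> l2_norm (A \<phi>) \<le> M * l2_norm \<phi>" "0 < M"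
    and diff: "\<And>\<phi> \<eta>. A (\<lambda>n. \<phi> n - \<eta> n) = (\<lambda>n. A \<phi> n - A \<eta> n)"
    and cont: "\<And>u \<phi> n. (\<And>n. (\<lambda>k::nat. u k n) \<longlonglongrightarrow> \<phi> n) \<Longrightarrow> (\<lambda>k. A (u k) n) \<longlonglongrightarrow> A \<phi> n"
    and w: "cmod w = 1" and c: "0 < c"
    and coercive: "\<And>\<phi>. \<phi> \<in> l2 \<Longrightarrow> c * (l2_norm \<phi>)\<^sup>2 \<le> Re (w * l2_inner \<phi> (A \<phi>))"
  obtains C where "\<And>\<eta>. \<eta> \<in> l2 \<Longrightarrow> \<exists>\<phi>\<in>l2. A \<phi> = \<eta> \<and> l2_norm \<phi> \<le> C * l2_norm \<eta>"
proof -
  \<comment> \<open>This \<open>t\<close> minimises \<open>1 - 2 t c + t\<^sup>2 M\<^sup>2\<close>, the bound on the squared contraction factor.\<close>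
  define t where "t = c / M\<^sup>2"
  define a where "a = complex_of_real t * w"
  define \<kappa> where "\<kappa> = sqrt (max 0 (1 - c\<^sup>2 / M\<^sup>2))"
  have t: "0 < t" using c M(3) by (simp add: t_def)
  have a0: "a \<noteq> 0" "cmod a = t" using t w by (auto simp: a_def norm_mult)
  have k: "0 \<le> \<kappa>" "\<kappa> < 1" using c M(3) by (auto simp: \<kappa>_def)
  have contraction: "l2_norm (\<lambda>n. \<phi> n - a * A \<phi> n) \<le> \<kappa> * l2_norm \<phi>" if p: "\<phi> \<in> l2" for \<phi>
  proof -
    note l = M(1)[OF p]
    have "l2_inner \<phi> (\<lambda>n. a * A \<phi> n) = a * l2_inner \<phi> (A \<phi>)"
      by (simp add: l2_inner_def infsum_cmult_right'[symmetric] mult.left_commute)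
    then have r: "Re (l2_inner \<phi> (\<lambda>n. a * A \<phi> n)) = t * Re (w * l2_inner \<phi> (A \<phi>))"
      by (simp add: a_def mult.assoc)
    have "l2_norm (\<lambda>n. a * A \<phi> n) \<le> t * (M * l2_norm \<phi>)"
      using l2_scale(2)[OF l, of a] mult_left_mono[OF M(2)[OF p], of t] t unfolding a0(2) by linarith
    then have "(l2_norm (\<lambda>n. a * A \<phi> n))\<^sup>2 \<le> (t * (M * l2_norm \<phi>))\<^sup>2"
      by (rule power_mono) simp
    moreover have "t * (c * (l2_norm \<phi>)\<^sup>2) \<le> t * Re (w * l2_inner \<phi> (A \<phi>))"
      by (rule mult_left_mono[OF coercive[OF p]]) (use t in simp)
    ultimately have "(l2_norm (\<lambda>n. \<phi> n - a * A \<phi> n))\<^sup>2 \<le>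
        (l2_norm \<phi>)\<^sup>2 - 2 * (t * (c * (l2_norm \<phi>)\<^sup>2)) + (t * (M * l2_norm \<phi>))\<^sup>2"
      using l2_norm_sq_diff[OF p l2_scale(1)[OF l, of a]] r by linarith
    also have "\<dots> = (1 - c\<^sup>2 / M\<^sup>2) * (l2_norm \<phi>)\<^sup>2"
      using M(3) by (simp add: t_def power2_eq_square field_simps)
    also have "\<dots> \<le> max 0 (1 - c\<^sup>2 / M\<^sup>2) * (l2_norm \<phi>)\<^sup>2"
      by (rule mult_right_mono) auto
    also have "\<dots> = (\<kappa> * l2_norm \<phi>)\<^sup>2" by (simp add: \<kappa>_def power_mult_distrib)
    finally show ?thesis by (rule power2_le_imp_le) (use k in simp)
  qed
  have "\<exists>\<phi>\<in>l2. A \<phi> = \<eta> \<and> l2_norm \<phi> \<le> (t / (1 - \<kappa>)) * l2_norm \<eta>" if x: "\<eta> \<in> l2" for \<eta>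
  proof -
    define v where "v = (\<lambda>n. a * \<eta> n)"
    have v: "v \<in> l2" "l2_norm v \<le> t * l2_norm \<eta>"
      using l2_scale[OF x, of a] a0 by (auto simp: v_def)
    \<comment> \<open>The radius of a ball that is invariant under the iteration.\<close>
    define B where "B = l2_norm v / (1 - \<kappa>)"
    have B: "0 \<le> B" "l2_norm v + \<kappa> * B = B"
      using k by (auto simp: B_def field_simps)
    define step where "step = (\<lambda>u n. v n + (u n - a * A u n))"
    define u where "u k = (step ^^ k) (\<lambda>n. 0)" for k
    have u_Suc: "u (Suc k) = step (u k)" for k by (simp add: u_def)
    have rec: "u (Suc j) n = v n + (u j n - a * A (u j) n)" for j n
      by (simp only: u_Suc step_def)
    have step_l2: "step \<phi> \<in> l2" "l2_norm (step \<phi>) \<le> l2_norm v + \<kappa> * l2_norm \<phi>"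
      if p: "\<phi> \<in> l2" for \<phi>
    proof -
      have "(\<lambda>n. \<phi> n - a * A \<phi> n) \<in> l2" by (intro l2_diff p l2_scale M)
      from l2_add[OF v(1) this] contraction[OF p]
      show "step \<phi> \<in> l2" "l2_norm (step \<phi>) \<le> l2_norm v + \<kappa> * l2_norm \<phi>"
        by (auto simp: step_def)
    qed
    have u: "u k \<in> l2 \<and> l2_norm (u k) \<le> B" for k
    proof (induction k)
      case 0
      then show ?case using B by (simp add: u_def l2_zero)
    next
      case (Suc k)
      have "l2_norm v + \<kappa> * l2_norm (u k) \<le> B"
        using mult_left_mono[of "l2_norm (u k)" B \<kappa>] Suc k B(2) by auto
      then show ?case unfolding u_Suc using step_l2[of "u k"] Suc by auto
    qed
    have incr: "l2_norm (\<lambda>n. u (Suc k) n - u k n) \<le> \<kappa> ^ k * B" for k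
    proof (induction k)
      case 0
      show ?case using u[of 1] by (simp add: u_def)
    next
      case (Suc k)
      let ?d = "\<lambda>n. u (Suc k) n - u k n"
      have d: "?d \<in> l2" by (intro l2_diff) (use u in auto)
      have "(\<lambda>n. u (Suc (Suc k)) n - u (Suc k) n) = (\<lambda>n. ?d n - a * A ?d n)"
      proof
        fix n
        show "u (Suc (Suc k)) n - u (Suc k) n = ?d n - a * A ?d n"
          unfolding diff using rec[of "Suc k" n] rec[of k n] by algebra
      qed
      then have "l2_norm (\<lambda>n. u (Suc (Suc k)) n - u (Suc k) n) \<le> \<kappa> * l2_norm ?d"
        using contraction[OF d] by simp
      also have "\<dots> \<le> \<kappa> * (\<kappa> ^ k * B)" by (rule mult_left_mono[OF Suc k(1)])
      finally show ?case by simp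
    qed
    have "convergent (\<lambda>k. u k n)" for n
    proof -
      have "cmod (u (Suc k) n - u k n) \<le> \<kappa> ^ k * B" for k
        using cmod_le_l2_norm[OF l2_diff, of "u (Suc k)" "u k" n] u incr[of k]
        by (meson order_trans)
      note incr_pointwise = this
      have "summable (\<lambda>k. \<kappa> ^ k * B)"
        by (rule summable_mult2, rule summable_geometric) (use k in simp)
      then have "summable (\<lambda>k. u (Suc k) n - u k n)"
        by (rule summable_comparison_test'[where N = 0]) (rule incr_pointwise)
      then have "convergent (\<lambda>m. \<Sum>k<m. u (Suc k) n - u k n)"
        by (simp only: summable_iff_convergent)
      then show ?thesis
        by (simp only: sum_lessThan_telescope[of "\<lambda>k. u k n"] convergent_diff_const_right_iff)
    qed
    then obtain \<phi> where lim: "\<And>n. (\<lambda>k. u k n) \<longlonglongrightarrow> \<phi> n"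
      unfolding convergent_def by metis
    have "L2_set (\<lambda>n. cmod (\<phi> n)) F \<le> B" if F: "finite F" for F
    proof (rule tendsto_upperbound)
      show "(\<lambda>k. L2_set (\<lambda>n. cmod (u k n)) F) \<longlonglongrightarrow> L2_set (\<lambda>n. cmod (\<phi> n)) F"
        unfolding L2_set_def by (intro tendsto_intros lim)
      show "\<forall>\<^sub>F k in sequentially. L2_set (\<lambda>n. cmod (u k n)) F \<le> B"
        using L2_set_le_l2_norm[OF _ F] u by (meson always_eventually order_trans)
    qed auto
    note \<phi> = l2_L2_setI[OF B(1) this]
    have "A \<phi> n = \<eta> n" for n
    proof -
      have "(\<lambda>k. u (Suc k) n) \<longlonglongrightarrow> v n + (\<phi> n - a * A \<phi> n)"
        unfolding u_Suc step_def by (intro tendsto_intros lim cont)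
      moreover have "(\<lambda>k. u (Suc k) n) \<longlonglongrightarrow> \<phi> n" by (rule LIMSEQ_Suc[OF lim])
      ultimately have "v n + (\<phi> n - a * A \<phi> n) = \<phi> n" by (rule LIMSEQ_unique)
      then show ?thesis using a0 by (simp add: v_def)
    qed
    moreover have "B \<le> (t / (1 - \<kappa>)) * l2_norm \<eta>"
      using v(2) k by (simp add: B_def divide_right_mono)
    ultimately show ?thesis using \<phi> by (intro bexI[of _ \<phi>]) auto
  qed
  then show ?thesis using that by blast
qed

text \<open>Coercivity gives injectivity besides solvability, so the chosen solutions depend
  linearly on the right-hand side and form a bounded inverse.\<close>

lemma coercive_in_resolvent_set:
  fixes T :: "(int \<Rightarrow> complex) \<Rightarrow> (int \<Rightarrow> complex)"
  defines "A \<equiv> \<lambda>z \<phi> n. T \<phi> n - z * \<phi> n"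
  assumes T: "bounded_operator T"
    and lin: "\<And>a b \<phi> \<eta>. T (\<lambda>n. a * \<phi> n + b * \<eta> n) = (\<lambda>n. a * T \<phi> n + b * T \<eta> n)"
    and cont: "\<And>u \<phi> n. (\<And>n. (\<lambda>k::nat. u k n) \<longlonglongrightarrow> \<phi> n) \<Longrightarrow> (\<lambda>k. T (u k) n) \<longlonglongrightarrow> T \<phi> n"
    and w: "cmod w = 1" and c: "0 < c"
    and coercive: "\<And>\<phi>. \<phi> \<in> l2 \<Longrightarrow> c * (l2_norm \<phi>)\<^sup>2 \<le> Re (w * l2_inner \<phi> (A z \<phi>))"
  shows "z \<in> resolvent_set T"
proof -
  obtain M where M: "\<And>\<phi>. \<phi> \<in> l2 \<Longrightarrow> l2_norm (T \<phi>) \<le> M * l2_norm \<phi>"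
    using T unfolding bounded_operator_def by blast
  have Tl2: "T \<phi> \<in> l2" if "\<phi> \<in> l2" for \<phi> using T that unfolding bounded_operator_def by blast
  have A_lin: "A z (\<lambda>n. a * \<phi> n + b * \<eta> n) = (\<lambda>n. a * A z \<phi> n + b * A z \<eta> n)" for a b \<phi> \<eta>
    unfolding A_def lin by (simp add: algebra_simps)
  have A_diff: "A z (\<lambda>n. \<phi> n - \<eta> n) = (\<lambda>n. A z \<phi> n - A z \<eta> n)" for \<phi> \<eta>
    using A_lin[of 1 \<phi> "-1" \<eta>] by simp
  have A_l2: "A z \<phi> \<in> l2" "l2_norm (A z \<phi>) \<le> (\<bar>M\<bar> + cmod z + 1) * l2_norm \<phi>" if p: "\<phi> \<in> l2" for \<phi>
  proof -
    have s: "(\<lambda>n. (- z) * \<phi> n) \<in> l2" "l2_norm (\<lambda>n. (- z) * \<phi> n) \<le> cmod z * l2_norm \<phi>"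
      using l2_scale[OF p, of "- z"] by auto
    have e: "A z \<phi> = (\<lambda>n. T \<phi> n + (- z) * \<phi> n)" by (simp add: A_def)
    show "A z \<phi> \<in> l2" unfolding e by (rule l2_add(1)[OF Tl2[OF p] s(1)])
    have "M * l2_norm \<phi> \<le> \<bar>M\<bar> * l2_norm \<phi>" by (intro mult_right_mono) auto
    moreover have "0 \<le> l2_norm \<phi>" by simp
    ultimately show "l2_norm (A z \<phi>) \<le> (\<bar>M\<bar> + cmod z + 1) * l2_norm \<phi>"
      unfolding e distrib_right
      using l2_add(2)[OF Tl2[OF p] s(1)] s(2) M[OF p] by linarith
  qed
  obtain C where C: "\<And>\<eta>. \<eta> \<in> l2 \<Longrightarrow> \<exists>\<phi>\<in>l2. A z \<phi> = \<eta> \<and> l2_norm \<phi> \<le> C * l2_norm \<eta>"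
  proof (rule coercive_solvable[of "A z" "\<bar>M\<bar> + cmod z + 1" w c])
    show "(\<lambda>k. A z (u k) n) \<longlonglongrightarrow> A z \<phi> n" if "\<And>n. (\<lambda>k::nat. u k n) \<longlonglongrightarrow> \<phi> n" for u \<phi> n
      unfolding A_def by (intro tendsto_intros cont that)
    show "0 < \<bar>M\<bar> + cmod z + 1" using norm_ge_zero[of z] by linarith
  qed (use A_l2 A_diff w c coercive in auto)
  have inj: "\<phi> = \<eta>" if "\<phi> \<in> l2" "\<eta> \<in> l2" "A z \<phi> = A z \<eta>" for \<phi> \<eta>
  proof -
    let ?d = "\<lambda>n. \<phi> n - \<eta> n"
    have d: "?d \<in> l2" by (rule l2_diff[OF that(1,2)])
    have "A z ?d = (\<lambda>n. 0)" unfolding A_diff that(3) by simp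
    then have "c * (l2_norm ?d)\<^sup>2 \<le> 0" using coercive[OF d] by (simp add: l2_inner_def)
    then have "(l2_norm ?d)\<^sup>2 \<le> 0" using c by (simp add: mult_le_0_iff)
    then have "?d = (\<lambda>n. 0)" by (intro l2_norm_eq_0[OF d]) simp
    then show ?thesis by (metis eq_iff_diff_eq_0 ext)
  qed
  obtain R where R: "\<And>\<eta>. \<eta> \<in> l2 \<Longrightarrow> R \<eta> \<in> l2 \<and> A z (R \<eta>) = \<eta> \<and> l2_norm (R \<eta>) \<le> C * l2_norm \<eta>"
    using C by metis
  have R_eq: "R \<eta> = \<phi>" if "\<phi> \<in> l2" "A z \<phi> = \<eta>" for \<phi> \<eta>
    using inj[of "R \<eta>" \<phi>] R[of \<eta>] A_l2(1)[OF that(1)] that by auto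
  have "bounded_operator R"
    unfolding bounded_operator_def
  proof (intro conjI ballI allI exI[of _ C])
    fix \<phi> \<eta> assume p: "\<phi> \<in> l2" "\<eta> \<in> l2"
    show "R (\<lambda>n. \<phi> n + \<eta> n) = (\<lambda>n. R \<phi> n + R \<eta> n)"
    proof (rule R_eq)
      show "(\<lambda>n. R \<phi> n + R \<eta> n) \<in> l2" by (intro l2_add) (use R p in auto)
      show "A z (\<lambda>n. R \<phi> n + R \<eta> n) = (\<lambda>n. \<phi> n + \<eta> n)"
        using A_lin[of 1 "R \<phi>" 1 "R \<eta>"] R p by simp
    qed
  next
    fix a \<phi> assume p: "\<phi> \<in> l2"
    show "R (\<lambda>n. a * \<phi> n) = (\<lambda>n. a * R \<phi> n)"
    proof (rule R_eq)
      show "(\<lambda>n. a * R \<phi> n) \<in> l2" by (intro l2_scale) (use R p in auto)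
      show "A z (\<lambda>n. a * R \<phi> n) = (\<lambda>n. a * \<phi> n)"
        using A_lin[of a "R \<phi>" 0 "R \<phi>"] R p by simp
    qed
  qed (use R in auto)
  moreover have "R (\<lambda>n. T \<phi> n - z * \<phi> n) = \<phi>" if "\<phi> \<in> l2" for \<phi>
    using R_eq[OF that] by (simp add: A_def)
  moreover have "(\<lambda>n. T (R \<phi>) n - z * R \<phi> n) = \<phi>" if "\<phi> \<in> l2" for \<phi>
    using R[OF that] by (simp add: A_def)
  ultimately show ?thesis unfolding resolvent_set_def by blast
qed

section \<open>Ground states of Schroedinger operators\<close>

lemma schroedinger_linear:
  "schroedinger V (\<lambda>n. a * \<phi> n + b * \<eta> n) = (\<lambda>n. a * schroedinger V \<phi> n + b * schroedinger V \<eta> n)"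
  by (simp add: schroedinger_def algebra_simps)

lemma bounded_operator_schroedinger:
  assumes B: "\<And>n. \<bar>V n\<bar> \<le> B"
  shows "bounded_operator (schroedinger V)"
proof -
  have "schroedinger V \<phi> \<in> l2 \<and> l2_norm (schroedinger V \<phi>) \<le> (2 + B) * l2_norm \<phi>"
    if p: "\<phi> \<in> l2" for \<phi>
  proof -
    have B0: "0 \<le> B" using B[of 0] by linarith
    have v: "cmod (complex_of_real (V n) * \<phi> n) \<le> B * cmod (\<phi> n)" for n
      using B[of n] by (simp add: norm_mult mult_right_mono)
    note v = l2_dominated[OF p B0 v]
    note s = l2_shift[OF p, of 1] l2_shift[OF p, of "-1"]
    note h = l2_add[OF s(1,3)]
    show ?thesis
      using l2_add[OF h(1) v(1)] h(2) v(2) s(2,4)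
      by (simp add: schroedinger_def algebra_simps)
  qed
  moreover have "schroedinger V (\<lambda>n. \<phi> n + \<eta> n) = (\<lambda>n. schroedinger V \<phi> n + schroedinger V \<eta> n)"
    "schroedinger V (\<lambda>n. a * \<phi> n) = (\<lambda>n. a * schroedinger V \<phi> n)" for \<phi> \<eta> a
    by (simp_all add: schroedinger_def algebra_simps)
  ultimately show ?thesis unfolding bounded_operator_def by metis
qed

lemma l2_weighted_summable:
  assumes "\<phi> \<in> l2" and c: "\<And>n. \<bar>c n\<bar> \<le> (B::real)"
  shows "(\<lambda>n. c n * (cmod (\<phi> n))\<^sup>2) summable_on UNIV"
proof (rule abs_summable_summable, rule summable_on_comparison_test)
  show "(\<lambda>n. B * (cmod (\<phi> n))\<^sup>2) summable_on UNIV"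
    using assms(1) by (intro summable_on_cmult_right) (simp add: l2_def)
  show "norm (c n * (cmod (\<phi> n))\<^sup>2) \<le> B * (cmod (\<phi> n))\<^sup>2" for n
    by (simp add: abs_mult mult_right_mono c)
qed auto

lemma infsum_of_real:
  "f summable_on A \<Longrightarrow> (\<Sum>\<^sub>\<infinity>x\<in>A. complex_of_real (f x)) = complex_of_real (infsum f A)"
  by (rule infsumI[OF has_sum_of_real[OF has_sum_infsum]])

text \<open>The two hopping terms are complex conjugates of each other up to a shift of the summation
  index, so the quadratic form is real.\<close>

lemma schroedinger_form:
  assumes p: "\<phi> \<in> l2" and B: "\<And>n. \<bar>V n\<bar> \<le> B"
  shows "l2_inner \<phi> (schroedinger V \<phi>) =
    complex_of_real (2 * (\<Sum>\<^sub>\<infinity>n. Re (cnj (\<phi> n) * \<phi> (n + 1))) + (\<Sum>\<^sub>\<infinity>n. V n * (cmod (\<phi> n))\<^sup>2))"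
proof -
  let ?f = "\<lambda>n. cnj (\<phi> n) * \<phi> (n + 1)"
  let ?g = "\<lambda>n. cnj (\<phi> n) * \<phi> (n - 1)"
  let ?v = "\<lambda>n. V n * (cmod (\<phi> n))\<^sup>2"
  have f: "?f summable_on UNIV" by (rule summable_on_l2_inner[OF p l2_shift(1)[OF p]])
  have g: "?g summable_on UNIV" using summable_on_l2_inner[OF p l2_shift(1)[OF p, of "-1"]] by simp
  have v: "(\<lambda>n. complex_of_real (?v n)) summable_on UNIV"
    using l2_weighted_summable[OF p B] by (rule summable_on_of_real)
  have v_eq: "complex_of_real (?v n) = complex_of_real (V n) * (\<phi> n * cnj (\<phi> n))" for n
    by (simp only: of_real_mult complex_norm_square)
  have "infsum ?g UNIV = (\<Sum>\<^sub>\<infinity>n. ?g (n + 1))" by (rule infsum_int_shift(1)[symmetric])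
  also have "\<dots> = (\<Sum>\<^sub>\<infinity>n. cnj (?f n))" by (simp add: mult.commute)
  also have "\<dots> = cnj (infsum ?f UNIV)" by (rule infsum_cnj)
  finally have gf: "infsum ?g UNIV = cnj (infsum ?f UNIV)" .
  have "l2_inner \<phi> (schroedinger V \<phi>) = (\<Sum>\<^sub>\<infinity>n. (?f n + ?g n) + complex_of_real (?v n))"
    unfolding l2_inner_def schroedinger_def
    by (intro infsum_cong) (simp only: v_eq, simp add: algebra_simps)
  also have "\<dots> = (infsum ?f UNIV + infsum ?g UNIV) + (\<Sum>\<^sub>\<infinity>n. complex_of_real (?v n))"
    by (subst infsum_add[OF summable_on_add[OF f g] v], subst infsum_add[OF f g]) simp
  also have "\<dots> = complex_of_real (2 * Re (infsum ?f UNIV) + infsum ?v UNIV)"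
    unfolding gf complex_add_cnj infsum_of_real[OF l2_weighted_summable[OF p B]] by simp
  finally show ?thesis by (simp only: infsum_Re[OF f])
qed

text \<open>A positive solution bounds the form from above. With \<open>h(n) = \<psi>(n+1) / \<psi>(n)\<close>, weighting the
  arithmetic-geometric mean inequality for the bond \<open>{n, n+1}\<close> by \<open>h(n)\<close> puts the
  total weight \<open>h(n) + 1/h(n-1)\<close> on the site \<open>n\<close>, and the equation for \<open>\<psi>\<close> says that this is
  exactly \<open>E - V(n)\<close>.\<close>

lemma positive_solution_form_bound:
  assumes p: "\<phi> \<in> l2" and B: "\<And>n. \<bar>V n\<bar> \<le> B"
    and pos: "\<And>n. 0 < \<psi> n"
    and eq: "\<And>n. \<psi> (n + 1) + \<psi> (n - 1) + V n * \<psi> n = E * \<psi> (n::int)"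
  shows "2 * (\<Sum>\<^sub>\<infinity>n. Re (cnj (\<phi> n) * \<phi> (n + 1))) + (\<Sum>\<^sub>\<infinity>n. V n * (cmod (\<phi> n))\<^sup>2)
    \<le> E * (l2_norm \<phi>)\<^sup>2"
proof -
  define h where "h n = \<psi> (n + 1) / \<psi> n" for n
  have h0: "0 < h n" for n using pos by (simp add: h_def)
  have riccati: "h n + 1 / h (n - 1) = E - V n" for n
    using eq[of n] pos[of n] by (simp add: h_def field_simps)
  have up: "\<bar>h n\<bar> \<le> \<bar>E\<bar> + B" "\<bar>1 / h (n - 1)\<bar> \<le> \<bar>E\<bar> + B" for n
    using riccati[of n] B[of n] h0[of n] h0[of "n - 1"] zero_less_divide_1_iff[of "h (n - 1)"]
    by linarith+
  let ?q = "\<lambda>n. (cmod (\<phi> n))\<^sup>2"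
  have s1: "(\<lambda>n. h n * ?q n) summable_on UNIV" by (rule l2_weighted_summable[OF p up(1)])
  have s2: "(\<lambda>n. 1 / h (n - 1) * ?q n) summable_on UNIV" by (rule l2_weighted_summable[OF p up(2)])
  have s2': "(\<lambda>n. 1 / h n * ?q (n + 1)) summable_on UNIV"
    using infsum_int_shift(2)[of "\<lambda>n. 1 / h (n - 1) * ?q n" 1] s2 by simp
  have sv: "(\<lambda>n. V n * ?q n) summable_on UNIV" by (rule l2_weighted_summable[OF p B])
  have sr: "(\<lambda>n. Re (cnj (\<phi> n) * \<phi> (n + 1))) summable_on UNIV"
    by (rule summable_on_Re[OF summable_on_l2_inner[OF p l2_shift(1)[OF p]]])
  have am_gm: "2 * Re (cnj (\<phi> n) * \<phi> (n + 1)) \<le> h n * ?q n + 1 / h n * ?q (n + 1)" for n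
  proof -
    have "Re (cnj (\<phi> n) * \<phi> (n + 1)) \<le> cmod (\<phi> n) * cmod (\<phi> (n + 1))"
      using complex_Re_le_cmod[of "cnj (\<phi> n) * \<phi> (n + 1)"] by (simp add: norm_mult)
    moreover have "0 \<le> (h n * cmod (\<phi> n) - cmod (\<phi> (n + 1)))\<^sup>2 / h n" using h0[of n] by simp
    moreover have "(h n * x - y)\<^sup>2 / h n = h n * x\<^sup>2 + 1 / h n * y\<^sup>2 - 2 * (x * y)" for x y
      using h0[of n] by (simp add: power2_eq_square field_simps)
    ultimately show ?thesis by simp
  qed
  have "2 * (\<Sum>\<^sub>\<infinity>n. Re (cnj (\<phi> n) * \<phi> (n + 1))) = (\<Sum>\<^sub>\<infinity>n. 2 * Re (cnj (\<phi> n) * \<phi> (n + 1)))"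
    by (simp only: infsum_cmult_right')
  also have "\<dots> \<le> (\<Sum>\<^sub>\<infinity>n. h n * ?q n + 1 / h n * ?q (n + 1))"
    by (intro infsum_mono summable_on_cmult_right sr summable_on_add s1 s2' am_gm)
  also have "\<dots> = (\<Sum>\<^sub>\<infinity>n. h n * ?q n) + (\<Sum>\<^sub>\<infinity>n. 1 / h n * ?q (n + 1))"
    by (rule infsum_add[OF s1 s2'])
  also have "(\<Sum>\<^sub>\<infinity>n. 1 / h n * ?q (n + 1)) = (\<Sum>\<^sub>\<infinity>n. 1 / h (n - 1) * ?q n)"
    using infsum_int_shift(1)[of "\<lambda>n. 1 / h (n - 1) * ?q n" 1] by simp
  also have "(\<Sum>\<^sub>\<infinity>n. h n * ?q n) + \<dots> = (\<Sum>\<^sub>\<infinity>n. h n * ?q n + 1 / h (n - 1) * ?q n)"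
    by (rule infsum_add[OF s1 s2, symmetric])
  finally have "2 * (\<Sum>\<^sub>\<infinity>n. Re (cnj (\<phi> n) * \<phi> (n + 1))) + (\<Sum>\<^sub>\<infinity>n. V n * ?q n)
      \<le> (\<Sum>\<^sub>\<infinity>n. h n * ?q n + 1 / h (n - 1) * ?q n) + (\<Sum>\<^sub>\<infinity>n. V n * ?q n)" by simp
  also have "\<dots> = (\<Sum>\<^sub>\<infinity>n. (h n * ?q n + 1 / h (n - 1) * ?q n) + V n * ?q n)"
    by (rule infsum_add[OF summable_on_add[OF s1 s2] sv, symmetric])
  also have "\<dots> = (\<Sum>\<^sub>\<infinity>n. E * ?q n)"
    by (intro infsum_cong) (simp only: distrib_right[symmetric] riccati, simp)
  also have "\<dots> = E * (l2_norm \<phi>)\<^sup>2" by (simp only: infsum_cmult_right' l2_norm_sq)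
  finally show ?thesis .
qed

text \<open>The numerical range of the operator is contained in \<open>(-\<infinity>, E]\<close> by the form bound, and a point
  off this ray is at positive distance from it, so coercivity applies after a
  rotation. The eigenfunction puts \<open>E\<close> itself into the spectrum.\<close>

lemma is_max_spectrum_of_positive_eigenfunction:
  assumes B: "\<And>n. \<bar>V n\<bar> \<le> B"
    and pos: "\<And>n. 0 < \<psi> n"
    and eq: "\<And>n. \<psi> (n + 1) + \<psi> (n - 1) + V n * \<psi> n = E * \<psi> (n::int)"
    and l2: "(\<lambda>n. complex_of_real (\<psi> n)) \<in> l2"
  shows "eigenfunction (schroedinger V) (complex_of_real E) (\<lambda>n. complex_of_real (\<psi> n))"
    and "is_max_spectrum V E"
proof -
  let ?H = "schroedinger V" and ?\<psi> = "\<lambda>n. complex_of_real (\<psi> n)"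
  have "?H ?\<psi> n = complex_of_real E * ?\<psi> n" for n
  proof -
    have "?H ?\<psi> n = complex_of_real (\<psi> (n + 1) + \<psi> (n - 1) + V n * \<psi> n)"
      by (simp add: schroedinger_def)
    then show ?thesis by (simp only: eq of_real_mult)
  qed
  moreover have nz: "?\<psi> \<noteq> (\<lambda>n. 0)" using pos[of 0] by (auto simp: fun_eq_iff intro!: exI[of _ 0])
  ultimately show ef: "eigenfunction ?H (complex_of_real E) ?\<psi>"
    using l2 by (auto simp: eigenfunction_def)
  have "complex_of_real E \<notin> resolvent_set ?H"
  proof
    assume "complex_of_real E \<in> resolvent_set ?H"
    then obtain R where R: "bounded_operator R"
      "R (\<lambda>n. ?H ?\<psi> n - complex_of_real E * ?\<psi> n) = ?\<psi>"
      using l2 unfolding resolvent_set_def by blast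
    have "R (\<lambda>n. 0 * 0) = (\<lambda>n. 0 * R (\<lambda>n. 0) n)"
      using R(1) l2_zero(1) unfolding bounded_operator_def by meson
    then have "R (\<lambda>n. 0) = (\<lambda>n. 0)" by simp
    then show False using R(2) ef nz by (simp add: eigenfunction_def)
  qed
  moreover have "z \<in> \<real> \<and> Re z \<le> E" if z: "z \<in> spectrum ?H" for z
  proof (rule ccontr)
    assume not: "\<not> ?thesis"
    \<comment> \<open>The numerical range of \<open>H - z\<close> lies on the ray \<open>(-\<infinity>, E] - z\<close>, and \<open>w\<close> rotates this ray
      into the half-plane of numbers with real part at least \<open>c\<close>.\<close>
    define w where "w = (if Im z = 0 then - 1 else \<i> * complex_of_real (sgn (Im z)))"
    define c where "c = (if Im z = 0 then Re z - E else \<bar>Im z\<bar>)"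
    have "cmod w = 1" "0 < c"
      using not by (auto simp: w_def c_def norm_mult abs_sgn_eq complex_is_Real_iff)
    moreover have "c * (l2_norm \<phi>)\<^sup>2 \<le> Re (w * l2_inner \<phi> (\<lambda>n. ?H \<phi> n - z * \<phi> n))"
      if p: "\<phi> \<in> l2" for \<phi>
    proof -
      have Hp: "?H \<phi> \<in> l2"
        using bounded_operator_schroedinger[OF B] p by (auto simp: bounded_operator_def)
      define F where "F = 2 * (\<Sum>\<^sub>\<infinity>n. Re (cnj (\<phi> n) * \<phi> (n + 1))) + (\<Sum>\<^sub>\<infinity>n. V n * (cmod (\<phi> n))\<^sup>2)"
      have pp: "(\<Sum>\<^sub>\<infinity>n. cnj (\<phi> n) * \<phi> n) = complex_of_real ((l2_norm \<phi>)\<^sup>2)"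
        using p by (subst mult.commute)
          (simp only: l2_norm_sq infsum_of_real[symmetric] complex_norm_square l2_def mem_Collect_eq)
      have "l2_inner \<phi> (\<lambda>n. ?H \<phi> n - z * \<phi> n)
          = (\<Sum>\<^sub>\<infinity>n. cnj (\<phi> n) * ?H \<phi> n + (- z) * (cnj (\<phi> n) * \<phi> n))"
        unfolding l2_inner_def by (intro infsum_cong) (simp add: algebra_simps)
      also have "\<dots> = l2_inner \<phi> (?H \<phi>) + (- z) * complex_of_real ((l2_norm \<phi>)\<^sup>2)"
        unfolding pp[symmetric] infsum_cmult_right'[symmetric] l2_inner_def
        by (intro infsum_add summable_on_l2_inner p Hp summable_on_cmult_right)
      finally have inner_eq: "l2_inner \<phi> (\<lambda>n. ?H \<phi> n - z * \<phi> n)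
          = complex_of_real F - z * complex_of_real ((l2_norm \<phi>)\<^sup>2)" (is "?X = _")
        by (simp add: schroedinger_form[OF p B] F_def)
      have "Re ?X = F - Re z * (l2_norm \<phi>)\<^sup>2" "Im ?X = - Im z * (l2_norm \<phi>)\<^sup>2"
        unfolding inner_eq by simp_all
      moreover have "F \<le> E * (l2_norm \<phi>)\<^sup>2"
        unfolding F_def by (rule positive_solution_form_bound[OF p B pos eq])
      ultimately show ?thesis
        by (cases "Im z = 0") (simp_all add: w_def c_def abs_if sgn_if left_diff_distrib)
    qed
    ultimately have "z \<in> resolvent_set ?H"
      by (intro coercive_in_resolvent_set[where w = w and c = c] bounded_operator_schroedinger[OF B]
          schroedinger_linear) (auto simp: schroedinger_def intro!: tendsto_intros)
    then show False using z by (simp add: spectrum_def)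
  qed
  ultimately show "is_max_spectrum V E" by (auto simp: is_max_spectrum_def spectrum_def)
qed

lemma summable_on_power_abs:
  assumes "0 \<le> x" "x < (1::real)"
  shows "(\<lambda>n::int. x ^ nat \<bar>n\<bar>) summable_on UNIV"
proof -
  have geo: "(\<lambda>n::nat. x ^ n) summable_on UNIV"
    by (rule norm_summable_imp_summable_on) (use assms in \<open>simp add: summable_geometric\<close>)
  have 1: "(\<lambda>n::int. x ^ nat \<bar>n\<bar>) summable_on range int"
    by (subst summable_on_reindex) (use geo in \<open>auto simp: o_def inj_on_def\<close>)
  have 2: "(\<lambda>n::int. x ^ nat \<bar>n\<bar>) summable_on range (\<lambda>k. - int k)"
    by (subst summable_on_reindex) (use geo in \<open>auto simp: o_def inj_on_def\<close>)
  have "(UNIV::int set) = range int \<union> range (\<lambda>k. - int k)"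
    by (auto simp: image_iff) (metis int_cases2)
  then show ?thesis using summable_on_union[OF 1 2] by simp
qed

lemma l2_of_geometric_decay:
  assumes "0 \<le> x" "x < (1::real)" and le: "\<And>n. cmod (\<phi> n) \<le> x ^ nat \<bar>n\<bar>"
  shows "\<phi> \<in> l2"
  unfolding l2_def
proof (clarify, rule summable_on_comparison_test)
  show "(\<lambda>n::int. (x\<^sup>2) ^ nat \<bar>n\<bar>) summable_on UNIV"
    by (rule summable_on_power_abs) (use assms in \<open>auto simp: abs_square_less_1\<close>)
  show "(cmod (\<phi> n))\<^sup>2 \<le> (x\<^sup>2) ^ nat \<bar>n\<bar>" for n
    using power_mono[OF le[of n], of 2] by (simp add: power_mult[symmetric] mult.commute)
qed auto

lemma l2_tendsto_zero:
  assumes "\<phi> \<in> l2"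
  shows "(\<lambda>k::nat. \<phi> (int k)) \<longlonglongrightarrow> 0"
proof -
  have "(\<lambda>n. (cmod (\<phi> n))\<^sup>2) summable_on range int"
    using assms by (auto simp: l2_def intro: summable_on_subset_banach)
  then have "(\<lambda>k. (cmod (\<phi> (int k)))\<^sup>2) summable_on (UNIV::nat set)"
    by (subst (asm) summable_on_reindex) (auto simp: o_def inj_on_def)
  then have "summable (\<lambda>k. (cmod (\<phi> (int k)))\<^sup>2)" by (rule summable_on_imp_summable)
  then have "(\<lambda>k. (cmod (\<phi> (int k)))\<^sup>2) \<longlonglongrightarrow> 0" by (rule summable_LIMSEQ_zero)
  then have "(\<lambda>k. sqrt ((cmod (\<phi> (int k)))\<^sup>2)) \<longlonglongrightarrow> sqrt 0" by (rule tendsto_real_sqrt)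
  then show ?thesis by (simp add: tendsto_norm_zero_iff)
qed

text \<open>The Wronskian of two solutions is constant, and it tends to zero along square-summable
  ones.\<close>

lemma eigenfunction_proportional:
  assumes pos: "\<And>n. 0 < \<psi> n"
    and psi: "eigenfunction (schroedinger V) z (\<lambda>n. complex_of_real (\<psi> n))"
    and phi: "eigenfunction (schroedinger V) z \<phi>"
  obtains a where "a \<noteq> 0" "\<And>n. \<phi> n = a * complex_of_real (\<psi> n)"
proof -
  let ?p = "\<lambda>n. complex_of_real (\<psi> n)"
  have nz: "?p n \<noteq> 0" for n using pos[of n] by simp
  have eq: "?p (n + 1) + ?p (n - 1) + complex_of_real (V n) * ?p n = z * ?p n"
    "\<phi> (n + 1) + \<phi> (n - 1) + complex_of_real (V n) * \<phi> n = z * \<phi> n" for n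
    using psi phi by (auto simp: eigenfunction_def schroedinger_def dest!: fun_cong[where x = n])
  define W where "W n = \<phi> (n + 1) * ?p n - \<phi> n * ?p (n + 1)" for n
  have "W n = W (n - 1)" for n
  proof -
    have a: "\<phi> (n + 1) = z * \<phi> n - \<phi> (n - 1) - complex_of_real (V n) * \<phi> n"
      "?p (n + 1) = z * ?p n - ?p (n - 1) - complex_of_real (V n) * ?p n"
      using eq[of n] by (auto simp: algebra_simps)
    show ?thesis unfolding W_def a by (simp add: algebra_simps)
  qed
  then have step: "W (n + 1) = W n" for n by (metis add_diff_cancel_right')
  have const: "W n = W 0" for n
  proof (induction n rule: int_induct[of _ 0])
    case (step2 i)
    then show ?case using step[of "i - 1"] by simp
  qed (use step in auto)
  have l2: "\<phi> \<in> l2" "?p \<in> l2" using psi phi by (auto simp: eigenfunction_def)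
  note s = l2_shift(1)[OF l2(1), of 1] l2_shift(1)[OF l2(2), of 1]
  have "(\<lambda>k::nat. W 0) = (\<lambda>k. W (int k))" by (rule ext, rule const[symmetric])
  also have "\<dots> \<longlonglongrightarrow> 0 * 0 - 0 * 0"
    unfolding W_def by (intro tendsto_intros l2_tendsto_zero[OF l2(1)] l2_tendsto_zero[OF l2(2)]
        l2_tendsto_zero[OF s(1)] l2_tendsto_zero[OF s(2)])
  finally have "W 0 = 0" by (simp add: LIMSEQ_const_iff)
  then have "W n = 0" for n using const[of n] by (rule trans[rotated])
  then have "\<phi> (n + 1) * ?p n = \<phi> n * ?p (n + 1)" for n
    by (simp only: W_def right_minus_eq)
  then have step': "\<phi> (n + 1) / ?p (n + 1) = \<phi> n / ?p n" for n
    by (simp only: frac_eq_eq[OF nz nz])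
  have "\<phi> n / ?p n = \<phi> 0 / ?p 0" for n
  proof (induction n rule: int_induct[of _ 0])
    case (step2 i)
    then show ?case using step'[of "i - 1"] by simp
  qed (use step' in auto)
  then have phi_eq: "\<phi> n = (\<phi> 0 / ?p 0) * ?p n" for n using nz[of n] by (metis nonzero_eq_divide_eq)
  moreover have "\<phi> 0 / ?p 0 \<noteq> 0"
  proof
    assume "\<phi> 0 / ?p 0 = 0"
    then have "\<phi> = (\<lambda>n. 0)" using phi_eq by (metis ext mult_zero_left)
    then show False using phi by (simp add: eigenfunction_def)
  qed
  ultimately show ?thesis using that by blast
qed

lemma ground_state_of_decaying_solution:
  fixes E :: real
  assumes B: "\<And>n. \<bar>V n\<bar> \<le> B" and x: "0 < x" "x < 1"
    and pos: "\<And>n. 0 < \<psi> n" and decay: "\<And>n. \<psi> n \<le> x ^ nat \<bar>n\<bar>"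
    and eq: "\<And>n. \<psi> (n + 1) + \<psi> (n - 1) + V n * \<psi> n = E * \<psi> (n::int)"
  shows "is_max_spectrum V E"
    and "eigenvalue (schroedinger V) (complex_of_real E)"
    and "eigenfunction (schroedinger V) (complex_of_real E) \<phi> \<Longrightarrow>
      exp_decaying \<phi> \<and> positive_up_to_constant \<phi>"
proof -
  have "cmod (complex_of_real (\<psi> n)) \<le> x ^ nat \<bar>n\<bar>" for n
    using decay[of n] pos[of n] by simp
  then have l2: "(\<lambda>n. complex_of_real (\<psi> n)) \<in> l2"
    by (intro l2_of_geometric_decay[of x]) (use x in auto)
  note ef = is_max_spectrum_of_positive_eigenfunction(1)[OF B pos eq l2]
  show "is_max_spectrum V E" by (rule is_max_spectrum_of_positive_eigenfunction(2)[OF B pos eq l2])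
  show "eigenvalue (schroedinger V) (complex_of_real E)"
    using ef by (auto simp: eigenvalue_def)
  assume "eigenfunction (schroedinger V) (complex_of_real E) \<phi>"
  then obtain a where a: "a \<noteq> 0" "\<And>n. \<phi> n = a * complex_of_real (\<psi> n)"
    using eigenfunction_proportional[OF pos ef] by metis
  have "cmod (\<phi> n) \<le> cmod a * exp (- (- ln x) * real_of_int \<bar>n\<bar>)" for n
  proof -
    have "x ^ nat \<bar>n\<bar> = exp (real (nat \<bar>n\<bar>) * ln x)"
      by (simp only: exp_of_nat_mult exp_ln[OF x(1)])
    also have "\<dots> = exp (- (- ln x) * real_of_int \<bar>n\<bar>)" by (simp add: mult.commute)
    finally show ?thesis
      using mult_left_mono[OF decay[of n], of "cmod a"] pos[of n] by (simp add: a(2) norm_mult)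
  qed
  moreover have "0 < - ln x" using x by simp
  ultimately have "exp_decaying \<phi>" unfolding exp_decaying_def by blast
  moreover have "positive_up_to_constant \<phi>"
    unfolding positive_up_to_constant_def
  proof (intro exI[of _ "1 / a"] allI)
    fix n
    have "1 / a * \<phi> n = complex_of_real (\<psi> n)" using a(1) by (simp add: a(2))
    then show "1 / a * \<phi> n \<in> \<real> \<and> 0 < Re (1 / a * \<phi> n)" using pos[of n] by simp
  qed
  ultimately show "exp_decaying \<phi> \<and> positive_up_to_constant \<phi>" by simp
qed

text \<open>The solution is the product of the ratios, to the right along \<open>a\<close> and to the left along \<open>b\<close>;
  \<open>centre\<close> is the equation at the site 0, where the two halves meet.\<close>

lemma solution_of_ratios:
  fixes a b :: "nat \<Rightarrow> real" and V :: "int \<Rightarrow> real"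
  assumes a: "\<And>j. 0 < a j" "\<And>j. a j \<le> x" and b: "\<And>j. 0 < b j" "\<And>j. b j \<le> x"
    and right: "\<And>j. a (Suc j) + 1 / a j + V (int j + 1) = E"
    and left: "\<And>j. b (Suc j) + 1 / b j + V (- int j - 1) = E"
    and centre: "a 0 + b 0 + V 0 = E"
  obtains \<psi> where "\<And>n. 0 < \<psi> n" "\<And>n. \<psi> n \<le> x ^ nat \<bar>n\<bar>"
    "\<And>n. \<psi> (n + 1) + \<psi> (n - 1) + V n * \<psi> n = E * \<psi> (n::int)"
proof
  define P where "P c n = (\<Prod>j<n. c j)" for c :: "nat \<Rightarrow> real" and n
  define \<psi> where "\<psi> n = (if 0 \<le> n then P a (nat n) else P b (nat (- n)))" for n :: int
  have P_pos: "0 < P c n" if "\<And>j. 0 < c j" for c n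
    unfolding P_def using that by (intro prod_pos) simp
  have P_le: "P c n \<le> x ^ n" if "\<And>j. 0 < c j" "\<And>j. c j \<le> x" for c n
    unfolding P_def using prod_mono[of "{..<n}" c "\<lambda>_. x"] that by (simp add: less_imp_le)
  have psi_a: "\<psi> (int n) = P a n" and psi_b: "\<psi> (- int n) = P b n" for n
    by (auto simp: \<psi>_def P_def)
  show "0 < \<psi> n" for n using P_pos[of a, OF a(1)] P_pos[of b, OF b(1)] by (simp add: \<psi>_def)
  show "\<psi> n \<le> x ^ nat \<bar>n\<bar>" for n
    using P_le[of a "nat n", OF a] P_le[of b "nat (- n)", OF b] by (auto simp: \<psi>_def)
  \<comment> \<open>The recursion for the ratios is the eigenvalue equation divided by the value of the
    solution at the site in question.\<close>
  have chain: "P c (Suc (Suc j)) + P c j + v * P c (Suc j) = E * P c (Suc j)"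
    if "\<And>j. 0 < c j" "c (Suc j) + 1 / c j + v = E" for c j v
  proof -
    have "P c (Suc (Suc j)) + P c j + v * P c (Suc j) = (c (Suc j) + 1 / c j + v) * P c (Suc j)"
      using that(1)[of j] by (simp add: P_def field_simps)
    then show ?thesis by (simp only: that(2))
  qed
  show "\<psi> (n + 1) + \<psi> (n - 1) + V n * \<psi> n = E * \<psi> n" for n
  proof -
    consider "n = 0" | j where "n = int j + 1" | j where "n = - int j - 1"
      by (metis add.commute int_cases2 minus_add_distrib nat.exhaust of_nat_0 of_nat_Suc
          diff_conv_add_uminus minus_zero)
    then show ?thesis
    proof cases
      case 1
      then show ?thesis using centre psi_a[of 0] psi_a[of 1] psi_b[of 1] by (simp add: P_def)
    next
      case (2 j)
      then show ?thesis
        using chain[of a j "V (int j + 1)", OF a(1) right] psi_a[of "Suc (Suc j)"] psi_a[of "Suc j"] psi_a[of j]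
        by (simp add: add.commute)
    next
      case (3 j)
      have "\<psi> n = P b (Suc j)" "\<psi> (n + 1) = P b j" "\<psi> (n - 1) = P b (Suc (Suc j))"
        unfolding psi_b[symmetric] by (rule arg_cong[where f = \<psi>], simp add: 3)+
      then show ?thesis using chain[of b j "V n", OF b(1)] left[of j] by (simp add: 3)
    qed
  qed
qed

section \<open>The dynamics of the ratios\<close>

text \<open>If \<open>\<psi>\<close> is a positive solution and \<open>r(n) = \<psi>(n+1) / \<psi>(n)\<close>, then
  \<open>r(n+1) = E - V(n+1) - 1 / r(n)\<close>. So a potential on a half-line whose solution decays
  geometrically arises from any orbit of the two maps \<open>r \<mapsto> E - 1/r\<close> and
  \<open>r \<mapsto> E - 1/r - lam\<close> that stays in an interval \<open>[p, q]\<close> with \<open>q < 1\<close>. By \<open>rising\<close> the first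
  map pushes points of this interval up, by \<open>falling\<close> the second pushes them down, and
  by \<open>wide\<close> at least one of the two images always lies in the interval.\<close>

locale ratio_map =
  fixes lam E p q :: real
  assumes lam_pos: "0 < lam" and p_pos: "0 < p" and q_less_1: "q < 1"
    and wide: "p + 2 * lam \<le> q" and rising: "p + 1 / p < E" and falling: "E - lam < 2"
begin

definition free :: "real \<Rightarrow> real" where "free r = E - 1 / r"

definition branching :: "real \<Rightarrow> bool" where
  "branching r \<longleftrightarrow> p + lam \<le> free r \<and> free r \<le> q"

text \<open>The state of the process consists of a ratio and of a number in \<open>[0, 1)\<close>, whose binary
  digits are a supply of free choices. A digit is read, and then removed by the doubling map,
  whenever both maps keep the ratio in the interval; otherwise the symbol is forced.\<close>

definition symbol :: "real \<times> real \<Rightarrow> real" where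
  "symbol s =
    (if free (fst s) < p + lam then 0 else if q < free (fst s) then lam
     else if snd s < 1/2 then 0 else lam)"

definition step :: "real \<times> real \<Rightarrow> real \<times> real" where
  "step s = (free (fst s) - symbol s, if branching (fst s) then frac (2 * snd s) else snd s)"

definition orbit :: "real \<times> real \<Rightarrow> nat \<Rightarrow> real \<times> real" where
  "orbit s n = (step ^^ n) s"

definition code :: "real \<times> real \<Rightarrow> nat \<Rightarrow> real" where
  "code s n = symbol (orbit s n)"

text \<open>A lower bound, uniform over \<open>[p, q]\<close>, for the distance by which either map moves a ratio.\<close>

definition gap :: real where
  "gap = min (E - (p + 1 / p)) (2 - (E - lam))"

lemma gap_pos: "0 < gap"
  using rising falling by (simp add: gap_def)

lemma p_less_q: "p < q"
  using wide lam_pos by linarith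

lemma free_ge:
  assumes "p \<le> r" "r \<le> 1"
  shows "r + gap \<le> free r"
proof -
  have "0 < r" using assms p_pos by linarith
  have "p * r \<le> 1 * 1" using assms p_pos by (intro mult_mono) auto
  then have "0 \<le> (r - p) * (1 - p * r) / (p * r)"
    using assms p_pos \<open>0 < r\<close> by (intro divide_nonneg_pos mult_nonneg_nonneg) auto
  also have "\<dots> = (p + 1 / p) - (r + 1 / r)"
    using p_pos \<open>0 < r\<close> by (simp add: field_simps)
  finally show ?thesis by (auto simp: free_def gap_def)
qed

lemma free_le:
  assumes "0 < r"
  shows "free r - lam \<le> r - gap"
proof -
  have "0 \<le> (r - 1)\<^sup>2 / r" using assms by simp
  also have "\<dots> = r + 1 / r - 2" using assms by (simp add: power2_eq_square field_simps)
  finally show ?thesis by (auto simp: free_def gap_def)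
qed

lemma symbol_values: "symbol s \<in> {0, lam}"
  by (simp add: symbol_def)

lemma step_mem:
  assumes "fst s \<in> {p..q}"
  shows "fst (step s) \<in> {p..q}"
proof -
  have "p \<le> free (fst s)" "free (fst s) - lam \<le> q"
    using assms free_ge[of "fst s"] free_le[of "fst s"] gap_pos p_pos q_less_1 by auto
  then show ?thesis using wide lam_pos by (auto simp: step_def symbol_def)
qed

lemma orbit_0 [simp]: "orbit s 0 = s"
  by (simp add: orbit_def)

lemma orbit_Suc: "orbit s (Suc n) = step (orbit s n)"
  by (simp add: orbit_def)

lemma orbit_add: "orbit s (m + n) = orbit (orbit s m) n"
  by (simp add: orbit_def funpow_add add.commute[of m])

lemma code_add: "code s (m + n) = code (orbit s m) n"
  by (simp add: code_def orbit_add)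

lemma fst_orbit_Suc: "fst (orbit s (Suc n)) = E - 1 / fst (orbit s n) - code s n"
  by (simp add: orbit_Suc step_def code_def free_def)

lemma orbit_mem: "fst s \<in> {p..q} \<Longrightarrow> fst (orbit s n) \<in> {p..q}"
  by (induction n) (auto simp: orbit_Suc simp del: atLeastAtMost_iff intro: step_mem)

lemma snd_orbit_mem: "snd s \<in> {0..<1} \<Longrightarrow> snd (orbit s n) \<in> {0..<1}"
  by (induction n) (auto simp: orbit_Suc step_def frac_lt_1)

text \<open>As long as a symbol is forced upwards (or downwards), the ratio moves by at least \<open>gap\<close> in that
  direction, which the length of the interval permits only a bounded number of times. The
  direction cannot flip without a branching in between: a forced step down lands above
  \<open>q - lam\<close>, which is at least \<open>p + lam\<close>, and after a forced step up, which lands below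
  \<open>p + lam\<close>, the next free image is below \<open>p + 2 lam\<close>.\<close>

lemma branching_recurs:
  obtains N where "0 < N" "\<And>s. fst s \<in> {p..q} \<Longrightarrow> \<exists>j<N. branching (fst (orbit s j))"
proof -
  obtain N where N: "q - p < real N * gap" using gap_pos ex_less_of_nat_mult by blast
  have "\<exists>j<N. branching (fst (orbit s j))" if s: "fst s \<in> {p..q}" for s
  proof (rule ccontr)
    assume none: "\<not> ?thesis"
    define r where "r j = fst (orbit s j)" for j
    have r: "p \<le> r j" "r j \<le> q" for j using orbit_mem[OF s, of j] by (auto simp: r_def)
    have nb: "free (r j) < p + lam \<or> q < free (r j)" if "j < N" for j
    proof -
      have "\<not> branching (r j)" using none that by (auto simp: r_def)
      then show ?thesis by (auto simp: branching_def)
    qed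
    have r_Suc: "r (Suc j) = free (r j) - symbol (orbit s j)" for j
      by (simp add: r_def orbit_Suc step_def)
    have up: "r j + gap \<le> free (r j)" and down: "free (r j) - lam \<le> r j - gap" for j
      using free_ge[of "r j"] free_le[of "r j"] r[of j] p_pos q_less_1 by auto
    show False
    \<comment> \<open>The second conjunct of each induction claim excludes the opposite forced symbol.\<close>
    proof (cases "p + lam \<le> free (r 0)")
      case True
      have "j \<le> N \<Longrightarrow> r j \<le> r 0 - real j * gap \<and> p + lam \<le> free (r j)" for j
      proof (induction j)
        case (Suc j)
        then have high: "q < free (r j)" using nb[of j] by auto
        then have "r (Suc j) = free (r j) - lam"
          using p_less_q wide lam_pos r_Suc[of j] by (auto simp: symbol_def r_def)
        then show ?case
          using Suc high down[of j] up[of "Suc j"] wide gap_pos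
          by (auto simp: algebra_simps)
      qed (use True in simp)
      from this[of N] show False using N r[of N] r[of 0] by auto
    next
      case False
      have "j \<le> N \<Longrightarrow> r 0 + real j * gap \<le> r j \<and> free (r j) \<le> q" for j
      proof (induction j)
        case (Suc j)
        then have low: "free (r j) < p + lam" using nb[of j] by auto
        then have "r (Suc j) = free (r j)"
          using r_Suc[of j] by (auto simp: symbol_def r_def)
        then show ?case
          using Suc low up[of j] down[of "Suc j"] wide gap_pos
          by (auto simp: algebra_simps)
      qed (use False wide lam_pos in auto)
      from this[of N] show False using N r[of N] r[of 0] by auto
    qed
  qed
  moreover have "0 < N" using N p_less_q by (cases N) auto
  ultimately show ?thesis using that by blast
qed

lemma fst_orbit_eq:
  assumes "fst s = fst s'" "\<And>j. j < n \<Longrightarrow> code s j = code s' j"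
  shows "fst (orbit s n) = fst (orbit s' n)"
  using assms(2) by (induction n) (simp_all add: assms(1) fst_orbit_Suc)

text \<open>Equal symbols at a branching mean equal leading binary digits, so there the doubling map
  acts on both numbers by the same affine branch.\<close>

lemma step_expands:
  assumes "fst s = fst s'" "symbol s = symbol s'" "snd s \<in> {0..<1}" "snd s' \<in> {0..<1}"
  shows "\<bar>snd (step s) - snd (step s')\<bar> =
    (if branching (fst s) then 2 else 1) * \<bar>snd s - snd s'\<bar>"
proof (cases "branching (fst s)")
  case True
  have frac2: "frac (2 * x) = (if x < 1/2 then 2 * x else 2 * x - 1)" if "x \<in> {0..<1}" for x :: real
    using that by (auto simp: frac_unique_iff)
  have "snd s < 1/2 \<longleftrightarrow> snd s' < 1/2"
    using assms(1,2) True lam_pos by (auto simp: symbol_def branching_def split: if_splits)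
  then show ?thesis using True assms by (auto simp: step_def frac2 abs_if)
qed (use assms in \<open>simp add: step_def\<close>)

lemma orbit_expands:
  assumes eq: "fst s = fst s'" and s: "snd s \<in> {0..<1}" "snd s' \<in> {0..<1}"
    and agree: "\<And>j. j < n \<Longrightarrow> code s j = code s' j"
    and i: "i < n" "branching (fst (orbit s i))"
  shows "2 * \<bar>snd s - snd s'\<bar> \<le> \<bar>snd (orbit s n) - snd (orbit s' n)\<bar>"
proof -
  define D where "D j = \<bar>snd (orbit s j) - snd (orbit s' j)\<bar>" for j
  have D_nonneg: "0 \<le> D j" for j by (simp add: D_def)
  have D_Suc: "D (Suc j) = (if branching (fst (orbit s j)) then 2 else 1) * D j" if "j < n" for j
    unfolding D_def orbit_Suc
    by (intro step_expands fst_orbit_eq[OF eq] snd_orbit_mem s)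
       (use agree that in \<open>auto simp: code_def\<close>)
  have mono: "D j \<le> D (j + k)" if "j + k \<le> n" for j k
    using that
  proof (induction k)
    case (Suc k)
    then show ?case using D_Suc[of "j + k"] D_nonneg[of "j + k"] by (auto split: if_splits)
  qed simp
  have "2 * D 0 \<le> 2 * D i" using mono[of 0 i] i by simp
  also have "\<dots> = D (Suc i)" using D_Suc[of i] i by simp
  also have "\<dots> \<le> D n" using mono[of "Suc i" "n - Suc i"] i by simp
  finally show ?thesis by (simp add: D_def)
qed

text \<open>Each block of \<open>N\<close> common symbols contains a branching and so doubles the distance of the
  second components, which never exceeds 1.\<close>

lemma codes_separate:
  assumes N: "0 < N" "\<And>s. fst s \<in> {p..q} \<Longrightarrow> \<exists>j<N. branching (fst (orbit s j))"
    and s: "fst s \<in> {p..q}" "fst s = fst s'" "snd s \<in> {0..<1}" "snd s' \<in> {0..<1}"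
    and agree: "\<And>j. j < k * N \<Longrightarrow> code s j = code s' j"
  shows "\<bar>snd s - snd s'\<bar> \<le> (1/2) ^ k"
  using s agree
proof (induction k arbitrary: s s')
  case 0
  then show ?case by auto
next
  case (Suc k)
  have agree: "code s j = code s' j" if "j < N" for j using Suc.prems(5)[of j] that by simp
  obtain i where i: "i < N" "branching (fst (orbit s i))" using N(2)[OF Suc.prems(1)] by blast
  have "2 * \<bar>snd s - snd s'\<bar> \<le> \<bar>snd (orbit s N) - snd (orbit s' N)\<bar>"
    by (rule orbit_expands[OF Suc.prems(2,3,4) agree i])
  also have "\<dots> \<le> (1/2) ^ k"
  proof (rule Suc.IH)
    show "fst (orbit s N) \<in> {p..q}" by (rule orbit_mem[OF Suc.prems(1)])
    show "fst (orbit s N) = fst (orbit s' N)" by (rule fst_orbit_eq[OF Suc.prems(2) agree])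
    show "snd (orbit s N) \<in> {0..<1}" "snd (orbit s' N) \<in> {0..<1}"
      by (rule snd_orbit_mem, rule Suc.prems)+
    show "code (orbit s N) j = code (orbit s' N) j" if "j < k * N" for j
      using Suc.prems(5)[of "N + j"] that by (simp add: code_add)
  qed
  finally show ?case by simp
qed

end

section \<open>Hausdorff dimension\<close>

text \<open>This is the mass distribution principle with the mass transported from \<open>[0, 1)\<close>: a member
  \<open>U\<close> of a cover of \<open>S\<close> pulls back to a set lying in an interval of length
  \<open>C (diam U)\<^sup>a\<close>, and these intervals have to cover \<open>[0, 1)\<close>, so their lengths add up to
  at least 1.\<close>

lemma (in Metric_space) hausdorff_dim_ge_of_expanding:
  assumes S: "S \<subseteq> M" and a: "0 < a" and C: "0 < C"
    and G: "\<And>x. x \<in> {0..<1} \<Longrightarrow> G x \<in> S"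
    and expand: "\<And>x y. x \<in> {0..<1} \<Longrightarrow> y \<in> {0..<1} \<Longrightarrow> \<bar>x - y\<bar> \<le> C * d (G x) (G y) powr a"
  shows "hausdorff_dim S \<ge> ennreal a"
proof -
  have cover: "1 \<le> ennreal C * (\<Sum>i. diam_pow s (U i))"
    if s: "0 \<le> s" "s < a" and U: "\<And>i. U i \<subseteq> M" "\<And>i. ediam (U i) \<le> ennreal 1" "S \<subseteq> (\<Union>i. U i)"
    for s U
  proof -
    define A where "A i = {x\<in>{0..<1}. G x \<in> U i}" for i :: nat
    define L where "L i = C * enn2real (ediam (U i)) powr a" for i
    define J where "J i = (if A i = {} then {} else {Inf (A i)..Inf (A i) + L i})" for i
    have L0: "0 \<le> L i" for i using C by (simp add: L_def)
    have ediam_ge: "d x y \<le> enn2real (ediam (U i))" if "x \<in> U i" "y \<in> U i" for x y i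
    proof -
      have "ennreal (d x y) \<le> ediam (U i)"
        unfolding ediam_def using that by (meson SUP_upper2 order_refl)
      moreover have "ediam (U i) < top" using U(2)[of i] by (auto simp: le_less_trans)
      ultimately show ?thesis by (metis enn2real_mono enn2real_ennreal nonneg)
    qed
    have AJ: "A i \<subseteq> J i" for i
    proof
      fix x assume x: "x \<in> A i"
      have "x - L i \<le> y" if y: "y \<in> A i" for y
      proof -
        have "d (G x) (G y) powr a \<le> enn2real (ediam (U i)) powr a"
          using ediam_ge[of "G x" i "G y"] x y a by (intro powr_mono2) (auto simp: A_def)
        then have "C * d (G x) (G y) powr a \<le> L i" using C by (simp add: L_def)
        then show ?thesis using expand[of x y] x y by (auto simp: A_def)
      qed
      then have "x - L i \<le> Inf (A i)" using x by (intro cInf_greatest) auto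
      moreover have "Inf (A i) \<le> x"
        by (rule cInf_lower[OF x]) (auto simp: A_def intro!: bdd_belowI[of _ 0])
      ultimately show "x \<in> J i" using x by (auto simp: J_def)
    qed
    have le: "emeasure lborel (J i) \<le> ennreal C * diam_pow s (U i)" for i
    proof (cases "A i = {}")
      case False
      then have ne: "U i \<noteq> {}" by (auto simp: A_def)
      let ?D = "enn2real (ediam (U i))"
      have D: "0 \<le> ?D" "?D \<le> 1"
        using U(2)[of i] by (auto simp: enn2real_leI)
      have "?D powr a \<le> ?D powr s" if "s \<noteq> 0"
        using D s that by (cases "?D = 0") (auto intro: powr_mono')
      moreover have "?D powr a \<le> 1" using D a by (simp add: powr_le1)
      ultimately have "ennreal (?D powr a) \<le> diam_pow s (U i)"
        using ne by (auto simp: diam_pow_def intro: ennreal_leI)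
      then have "ennreal C * ennreal (?D powr a) \<le> ennreal C * diam_pow s (U i)"
        by (rule mult_left_mono) simp
      then show ?thesis using False L0[of i] C by (simp add: J_def L_def ennreal_mult)
    qed (simp add: J_def)
    have "1 = emeasure lborel {0..<1::real}" by simp
    also have "\<dots> \<le> emeasure lborel (\<Union>i. J i)"
    proof (rule emeasure_mono)
      show "{0..<1} \<subseteq> (\<Union>i. J i)"
      proof
        fix x :: real assume x: "x \<in> {0..<1}"
        then obtain i where "G x \<in> U i" using G U(3) by blast
        then show "x \<in> (\<Union>i. J i)" using AJ[of i] x by (auto simp: A_def)
      qed
    qed (auto simp: J_def)
    also have "\<dots> \<le> (\<Sum>i. emeasure lborel (J i))"
      by (rule emeasure_subadditive_countably) (auto simp: J_def)
    also have "\<dots> \<le> (\<Sum>i. ennreal C * diam_pow s (U i))"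
      by (intro suminf_le le summableI)
    finally show ?thesis by simp
  qed
  have "ennreal a \<le> ennreal s" if s: "0 \<le> s" "hausdorff_measure s S = 0" for s
  proof (rule ccontr)
    assume "\<not> ?thesis"
    then have sa: "s < a" by (simp add: ennreal_le_iff s not_le)
    have "ennreal (1 / C) \<le> hausdorff_premeasure s 1 S"
      unfolding hausdorff_premeasure_def
    proof (rule INF_greatest, clarify)
      fix U :: "nat \<Rightarrow> 'a set"
      assume "\<forall>i. U i \<subseteq> M \<and> ediam (U i) \<le> ennreal 1" "S \<subseteq> (\<Union>i. U i)"
      then have "1 \<le> ennreal C * (\<Sum>i. diam_pow s (U i))" by (intro cover s sa) auto
      then have "ennreal (1 / C) * 1 \<le> ennreal (1 / C) * (ennreal C * (\<Sum>i. diam_pow s (U i)))"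
        by (rule mult_left_mono) simp
      then show "ennreal (1 / C) \<le> (\<Sum>i. diam_pow s (U i))"
        using C by (simp add: mult.assoc[symmetric] ennreal_mult[symmetric])
    qed
    also have "\<dots> \<le> hausdorff_measure s S"
      unfolding hausdorff_measure_def by (rule SUP_upper) simp
    finally show False using s(2) C by simp
  qed
  then show ?thesis unfolding hausdorff_dim_def by (auto intro!: INF_greatest)
qed

section \<open>The Cantor set of potentials\<close>

lemma seq_dist_le_seq_dist_sum:
  assumes lam: "0 < lam" and V: "V \<in> two_valued lam" "V' \<in> two_valued lam"
  shows "lam * seq_dist V V' \<le> seq_dist_sum V V'"
proof (cases "V = V'")
  case True
  then show ?thesis by (simp add: seq_dist_def seq_dist_sum_def)
next
  case False
  define D where "D k \<longleftrightarrow> V (int k) \<noteq> V' (int k) \<or> V (- int k) \<noteq> V' (- int k)" for k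
  obtain n where "V n \<noteq> V' n" using False by auto
  then have "D (nat \<bar>n\<bar>)" by (cases "0 \<le> n") (auto simp: D_def)
  then have "D (LEAST k. D k)" by (rule LeastI)
  then obtain m where m: "V m \<noteq> V' m" "nat \<bar>m\<bar> = (LEAST k. D k)"
  proof (cases "V (int (LEAST k. D k)) = V' (int (LEAST k. D k))")
    case True
    then have "V (- int (LEAST k. D k)) \<noteq> V' (- int (LEAST k. D k))"
      using \<open>D (LEAST k. D k)\<close> D_def[of "LEAST k. D k"] by simp
    then show ?thesis using that[of "- int (LEAST k. D k)"] by simp
  next
    case False
    then show ?thesis using that[of "int (LEAST k. D k)"] by simp
  qed
  have "\<bar>V m - V' m\<bar> = lam" using m(1) V lam by (force simp: two_valued_def)
  then have "lam * seq_dist V V' = (\<Sum>n\<in>{m}. (1/2) ^ nat \<bar>n\<bar> * \<bar>V n - V' n\<bar>)"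
    using False m(2) by (simp add: seq_dist_def D_def)
  also have "\<dots> \<le> seq_dist_sum V V'"
    unfolding seq_dist_sum_def
    by (rule finite_sum_le_infsum[OF summable_on_seq_dist_sum[OF V]]) auto
  finally show ?thesis .
qed

context ratio_map
begin

text \<open>Varying the potential on one side of the origin already produces a Cantor set, so the left
  half is a fixed continuation that does not depend on \<open>t\<close>.\<close>

definition potential :: "real \<Rightarrow> int \<Rightarrow> real" where
  "potential t n =
    (if n = 0 then lam else if 0 < n then code (q, t) (nat (n - 1)) else code (q, 0) (nat (- n - 1)))"

lemma potential_two_valued: "potential t \<in> two_valued lam"
  using symbol_values by (auto simp: two_valued_def potential_def code_def)

text \<open>The condition \<open>centre\<close> is what makes the two half-line solutions match at the
  origin, since both of them have the initial ratio \<open>q\<close>.\<close>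

lemma potential_ground_state:
  assumes centre: "E = 2 * q + lam"
  shows "is_max_spectrum (potential t) E"
    and "eigenvalue (schroedinger (potential t)) (complex_of_real E)"
    and "eigenfunction (schroedinger (potential t)) (complex_of_real E) \<phi> \<Longrightarrow>
      exp_decaying \<phi> \<and> positive_up_to_constant \<phi>"
proof -
  define r where "r u j = fst (orbit (q, u) j)" for u j
  have r: "0 < r u j" "r u j \<le> q" for u j
    using orbit_mem[of "(q, u)" j] p_less_q p_pos by (auto simp: r_def)
  have rec: "r u (Suc j) + 1 / r u j + code (q, u) j = E" for u j
    by (simp add: r_def fst_orbit_Suc)
  obtain \<psi> where \<psi>: "\<And>n. 0 < \<psi> n" "\<And>n. \<psi> n \<le> q ^ nat \<bar>n\<bar>"
    "\<And>n. \<psi> (n + 1) + \<psi> (n - 1) + potential t n * \<psi> n = E * \<psi> n"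
  proof (rule solution_of_ratios[where a = "r t" and b = "r 0" and V = "potential t"])
    show "r t (Suc j) + 1 / r t j + potential t (int j + 1) = E" for j
      using rec[of t j] by (simp add: potential_def)
    show "r 0 (Suc j) + 1 / r 0 j + potential t (- int j - 1) = E" for j
      using rec[of 0 j] by (simp add: potential_def)
    have "r t 0 + r 0 0 + potential t 0 = 2 * q + lam" by (simp add: r_def potential_def)
    then show "r t 0 + r 0 0 + potential t 0 = E" by (simp only: centre[symmetric])
  qed (use r in auto)
  have "\<bar>potential t n\<bar> \<le> lam" for n
  proof -
    have "potential t n \<in> {0, lam}" using potential_two_valued[of t] by (simp add: two_valued_def)
    then show ?thesis using lam_pos by auto
  qed
  moreover have "0 < q" using p_pos p_less_q by linarith
  ultimately show "is_max_spectrum (potential t) E"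
    and "eigenvalue (schroedinger (potential t)) (complex_of_real E)"
    and "eigenfunction (schroedinger (potential t)) (complex_of_real E) \<phi> \<Longrightarrow>
      exp_decaying \<phi> \<and> positive_up_to_constant \<phi>"
    using ground_state_of_decaying_solution[OF _ _ q_less_1 \<psi>, of lam] by blast+
qed

text \<open>The exponent is \<open>1/N\<close>, where \<open>N\<close> bounds the waiting time for a branching: agreement up to
  distance \<open>K\<close> from the origin determines about \<open>K/N\<close> binary digits of \<open>t\<close>.\<close>

lemma potential_expanding:
  obtains a where "0 < a"
    "\<And>t t'. t \<in> {0..<1} \<Longrightarrow> t' \<in> {0..<1} \<Longrightarrow>
      \<bar>t - t'\<bar> \<le> 4 * seq_dist (potential t) (potential t') powr a"
proof -
  obtain N where N: "0 < N" "\<And>s. fst s \<in> {p..q} \<Longrightarrow> \<exists>j<N. branching (fst (orbit s j))"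
    using branching_recurs by blast
  have "\<bar>t - t'\<bar> \<le> 4 * seq_dist (potential t) (potential t') powr (1 / real N)"
    if t: "t \<in> {0..<1}" "t' \<in> {0..<1}" for t t'
  proof -
    have sep: "\<bar>t - t'\<bar> \<le> (1/2) ^ k"
      if "\<And>j. j < k * N \<Longrightarrow> code (q, t) j = code (q, t') j" for k
      using codes_separate[OF N, of "(q, t)" "(q, t')" k] that t p_less_q by auto
    have code_eq: "code (q, u) j = potential u (int (Suc j))" for u j by (simp add: potential_def)
    show ?thesis
    proof (cases "potential t = potential t'")
      case True
      have "\<bar>t - t'\<bar> \<le> (1/2) ^ k" for k by (rule sep) (simp add: code_eq True)
      moreover have "(\<lambda>k. (1/2::real) ^ k) \<longlonglongrightarrow> 0" by (rule LIMSEQ_realpow_zero) auto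
      ultimately have "\<bar>t - t'\<bar> \<le> 0" by (intro LIMSEQ_le_const) auto
      then show ?thesis by simp
    next
      case False
      define D where "D k \<longleftrightarrow> potential t (int k) \<noteq> potential t' (int k) \<or>
        potential t (- int k) \<noteq> potential t' (- int k)" for k
      define K where "K = (LEAST k. D k)"
      \<comment> \<open>Codes start at the site 1, so only \<open>K - 1\<close> of their symbols are known to agree.\<close>
      define k where "k = (K - 1) div N"
      have d: "seq_dist (potential t) (potential t') = (1/2) ^ K"
        using False by (simp add: seq_dist_def K_def D_def)
      have "\<bar>t - t'\<bar> \<le> (1/2) ^ k"
      proof (rule sep)
        fix j assume "j < k * N"
        also have "k * N \<le> K - 1" by (simp add: k_def)
        finally have "Suc j < K" by simp
        then have "\<not> D (Suc j)" unfolding K_def by (rule not_less_Least)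
        then show "code (q, t) j = code (q, t') j" by (simp add: code_eq D_def)
      qed
      also have "(1/2) ^ k = (1/2::real) powr real k" by (simp add: powr_realpow)
      also have "\<dots> \<le> (1/2) powr (real K / real N - 2)"
      proof (rule powr_mono')
        have "K - 1 < (k + 1) * N"
          unfolding k_def using N(1) by (simp add: dividend_less_div_times)
        then have "K \<le> (k + 1) * N" by linarith
        also have "\<dots> \<le> (k + 2) * N" by simp
        finally have "real K \<le> real ((k + 2) * N)" by (simp only: of_nat_le_iff)
        then show "real K / real N - 2 \<le> real k" using N(1) by (simp add: field_simps)
      qed auto
      also have "\<dots> = 4 * (1/2) powr (real K / real N)"
        by (simp add: powr_diff powr_numeral power2_eq_square)
      also have "(1/2::real) powr (real K / real N) = ((1/2) ^ K) powr (1 / real N)"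
        by (simp add: powr_powr powr_realpow[symmetric])
      finally show ?thesis by (simp only: d)
    qed
  qed
  moreover have "0 < 1 / real N" using N(1) by simp
  ultimately show ?thesis using that by blast
qed

lemma hausdorff_dim_potentials_pos:
  assumes "Metric_space (two_valued lam) d" and c: "0 < c"
    and le: "\<And>V V'. V \<in> two_valued lam \<Longrightarrow> V' \<in> two_valued lam \<Longrightarrow> c * seq_dist V V' \<le> d V V'"
    and S: "range potential \<subseteq> S" "S \<subseteq> two_valued lam"
  shows "Metric_space.hausdorff_dim (two_valued lam) d S > 0"
proof -
  interpret Metric_space "two_valued lam" d by fact
  obtain a where a: "0 < a" "\<And>t t'. t \<in> {0..<1} \<Longrightarrow> t' \<in> {0..<1} \<Longrightarrow>
      \<bar>t - t'\<bar> \<le> 4 * seq_dist (potential t) (potential t') powr a"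
    using potential_expanding by blast
  have "ennreal a \<le> hausdorff_dim S"
  proof (rule hausdorff_dim_ge_of_expanding[where G = potential and C = "4 * (1 / c) powr a"])
    fix t t' :: real assume t: "t \<in> {0..<1}" "t' \<in> {0..<1}"
    let ?V = "potential t" and ?V' = "potential t'"
    have "seq_dist ?V ?V' \<le> 1 / c * d ?V ?V'"
      using le[OF potential_two_valued potential_two_valued, of t t'] c by (simp add: field_simps)
    moreover have "0 \<le> seq_dist ?V ?V'" by (simp add: seq_dist_def)
    ultimately have "seq_dist ?V ?V' powr a \<le> (1 / c * d ?V ?V') powr a"
      using a(1) by (intro powr_mono2) auto
    also have "\<dots> = (1 / c) powr a * d ?V ?V' powr a"
      by (rule powr_mult)
    finally show "\<bar>t - t'\<bar> \<le> 4 * (1 / c) powr a * d ?V ?V' powr a" using a(2)[OF t] by simp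
  qed (use a(1) c S in auto)
  then show ?thesis using a(1) by (meson ennreal_less_zero_iff less_le_trans)
qed

end

theorem proposition3p1:
  shows "\<exists>lam0>0. \<forall>lam::real. 0 < lam \<and> lam < lam0 \<longrightarrow>
    (\<exists>\<epsilon>>0. admissible lam \<epsilon> \<and>
      (\<forall>E\<in>{2 + lam - \<epsilon><..<2 + lam}. \<forall>d\<in>{seq_dist, seq_dist_sum}.
         Metric_space.hausdorff_dim (two_valued lam) d
           {V \<in> two_valued lam. is_max_spectrum V E} > 0))"
proof (rule exI[of _ "1/40"], intro conjI allI impI)
  fix lam :: real
  assume lam: "0 < lam \<and> lam < 1/40"
  \<comment> \<open>The value of \<open>q\<close> is dictated by the matching at the origin. With \<open>p = 1 - 4 lam\<close> the
    interval is longer than \<open>2 lam\<close>, whereas \<open>p + 1/p - 2\<close> is only of second order in \<open>lam\<close>;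
    this is where \<open>lam\<close> has to be small.\<close>
  have ratio_map: "ratio_map lam E (1 - 4 * lam) ((E - lam) / 2)"
    if E: "E \<in> {2 + lam - lam / 4<..<2 + lam}" for E
  proof
    have "(1 - 4 * lam) + 1 / (1 - 4 * lam) = 2 + 16 * lam * lam / (1 - 4 * lam)"
      using lam by (simp add: field_simps)
    also have "16 * lam * lam / (1 - 4 * lam) \<le> lam * (1/2)"
    proof -
      have "16 * lam / (1 - 4 * lam) \<le> 1/2" using lam by (simp add: field_simps)
      from mult_left_mono[OF this, of lam] show ?thesis using lam by (simp add: mult_ac)
    qed
    finally show "(1 - 4 * lam) + 1 / (1 - 4 * lam) < E" using E lam by auto
  qed (use E lam in auto)
  show "\<exists>\<epsilon>>0. admissible lam \<epsilon> \<and>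
      (\<forall>E\<in>{2 + lam - \<epsilon><..<2 + lam}. \<forall>d\<in>{seq_dist, seq_dist_sum}.
         Metric_space.hausdorff_dim (two_valued lam) d
           {V \<in> two_valued lam. is_max_spectrum V E} > 0)"
  proof (intro exI[of _ "lam / 4"] conjI ballI)
    show "0 < lam / 4" using lam by simp
    show "admissible lam (lam / 4)"
      unfolding admissible_def
    proof (intro conjI ballI)
      fix E assume E: "E \<in> {2 + lam - lam / 4<..<2 + lam}"
      interpret ratio_map lam E "1 - 4 * lam" "(E - lam) / 2" by (rule ratio_map[OF E])
      have centre: "E = 2 * ((E - lam) / 2) + lam" by (simp add: field_simps)
      show "\<exists>V\<in>two_valued lam. is_max_spectrum V E \<and>
          eigenvalue (schroedinger V) (complex_of_real E) \<and>
          (\<forall>\<psi>. eigenfunction (schroedinger V) (complex_of_real E) \<psi> \<longrightarrow>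
             exp_decaying \<psi> \<and> positive_up_to_constant \<psi>)"
        using potential_ground_state[OF centre] potential_two_valued by blast
    qed (use lam in simp)
    fix E d assume E: "E \<in> {2 + lam - lam / 4<..<2 + lam}" and d: "d \<in> {seq_dist, seq_dist_sum}"
    interpret ratio_map lam E "1 - 4 * lam" "(E - lam) / 2" by (rule ratio_map[OF E])
    have centre: "E = 2 * ((E - lam) / 2) + lam" by (simp add: field_simps)
    obtain c where "0 < c" "\<And>V V'. V \<in> two_valued lam \<Longrightarrow> V' \<in> two_valued lam \<Longrightarrow>
        c * seq_dist V V' \<le> d V V'"
    proof (cases "d = seq_dist")
      case True
      then show ?thesis using that[of 1] by simp
    next
      case False
      then show ?thesis using that[of lam] d lam seq_dist_le_seq_dist_sum[of lam] by auto
    qed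
    moreover have "Metric_space (two_valued lam) d"
      using d Metric_space_seq_dist Metric_space_seq_dist_sum by auto
    moreover have "range potential \<subseteq> {V \<in> two_valued lam. is_max_spectrum V E}"
      using potential_two_valued potential_ground_state(1)[OF centre] by auto
    ultimately show "Metric_space.hausdorff_dim (two_valued lam) d
        {V \<in> two_valued lam. is_max_spectrum V E} > 0"
      using hausdorff_dim_potentials_pos by blast
  qed
qed simp

end
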